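(* For $\varepsilon>0$, let $D_\varepsilon\subset\mathbb{C}^2$ be the domain \[ D_\varepsilon=\{(z,w)\in\mathbb{C}^2 : (\log|z|)^2+(\log|w|)^2<\varepsilon^2\}. \] Then $D_\varepsilon$ is a bounded strictly pseudoconvex domain, and its boundary $M_\varepsilon:=\partial D_\varepsilon\subset\mathbb{C}^2$ is a compact strictly pseudoconvex CR manifold (of real dimension 3) without umbilical points.
   Context: A point $p$ of a three-dimensional strictly pseudoconvex CR manifold (e.g. a strictly pseudoconvex real hypersurface in $\mathbb{C}^2$) is called (CR) umbilical if Cartan's sixth-order CR curvature tensor vanishes at $p$; equivalently, in Chern–Moser normal form $\operatorname{Im} w = |z|^2 + \sum_{k,l\ge 2} N_{kl}(\operatorname{Re} w)\, z^k\bar z^l$ centered at $p$, the coefficient $N_{24}(0)$ vanishes. A hypersurface is locally spherical near $p$ if and only if every point near $p$ is umbilical. *)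

theory Defs
  imports "HOL-Analysis.Analysis"
begin

definition cmul :: "complex \<Rightarrow> complex \<times> complex \<Rightarrow> complex \<times> complex" where
  "cmul c p = (c * fst p, c * snd p)"

definition holo2_on :: "(complex \<times> complex) set \<Rightarrow> (complex \<times> complex \<Rightarrow> complex \<times> complex) \<Rightarrow> bool" where
  "holo2_on U f \<longleftrightarrow> (\<forall>p\<in>U. \<exists>L. (f has_derivative L) (at p) \<and> (\<forall>c v. L (cmul c v) = cmul c (L v)))"

definition biholo :: "(complex \<times> complex) set \<Rightarrow> (complex \<times> complex \<Rightarrow> complex \<times> complex) \<Rightarrow> bool" where
  "biholo U f \<longleftrightarrow> open U \<and> holo2_on U f \<and> inj_on f U \<and> open (f ` U) \<and>
     holo2_on (f ` U) (the_inv_into U f)"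

definition C2_fun :: "(complex \<times> complex) set \<Rightarrow> (complex \<times> complex \<Rightarrow> real)
   \<Rightarrow> (complex \<times> complex \<Rightarrow> (complex \<times> complex) \<Rightarrow>\<^sub>L real)
   \<Rightarrow> (complex \<times> complex \<Rightarrow> (complex \<times> complex) \<Rightarrow>\<^sub>L ((complex \<times> complex) \<Rightarrow>\<^sub>L real)) \<Rightarrow> bool" where
  "C2_fun U \<rho> \<rho>1 \<rho>2 \<longleftrightarrow> open U \<and>
     (\<forall>q\<in>U. (\<rho> has_derivative blinfun_apply (\<rho>1 q)) (at q)) \<and>
     (\<forall>q\<in>U. (\<rho>1 has_derivative blinfun_apply (\<rho>2 q)) (at q)) \<and>
     continuous_on U \<rho>2"

text \<open>Levi form sum_{j,k} rho_{j kbar} t_j conj(t_k), written via the real Hessian: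
  it equals (D^2 rho(t,t) + D^2 rho(it,it)) / 4.\<close>
definition levi_form ::
  "(complex \<times> complex \<Rightarrow> (complex \<times> complex) \<Rightarrow>\<^sub>L ((complex \<times> complex) \<Rightarrow>\<^sub>L real))
    \<Rightarrow> complex \<times> complex \<Rightarrow> complex \<times> complex \<Rightarrow> real" where
  "levi_form \<rho>2 q t = (blinfun_apply (blinfun_apply (\<rho>2 q) t) t
      + blinfun_apply (blinfun_apply (\<rho>2 q) (cmul \<i> t)) (cmul \<i> t)) / 4"

text \<open>d rho(q) <> 0 and the Levi form is positive definite on the complex tangent space
  H_q = {t. d rho(q) t = 0 and d rho(q)(i t) = 0} (i.e. sum_j rho_j(q) t_j = 0).\<close>
definition levi_pos_at ::
  "(complex \<times> complex \<Rightarrow> (complex \<times> complex) \<Rightarrow>\<^sub>L real)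
   \<Rightarrow> (complex \<times> complex \<Rightarrow> (complex \<times> complex) \<Rightarrow>\<^sub>L ((complex \<times> complex) \<Rightarrow>\<^sub>L real))
   \<Rightarrow> complex \<times> complex \<Rightarrow> bool" where
  "levi_pos_at \<rho>1 \<rho>2 q \<longleftrightarrow> \<rho>1 q \<noteq> 0 \<and>
     (\<forall>t. t \<noteq> 0 \<and> blinfun_apply (\<rho>1 q) t = 0 \<and> blinfun_apply (\<rho>1 q) (cmul \<i> t) = 0
          \<longrightarrow> levi_form \<rho>2 q t > 0)"

definition spsc_domain :: "(complex \<times> complex) set \<Rightarrow> bool" where
  "spsc_domain D \<longleftrightarrow> open D \<and> connected D \<and> D \<noteq> {} \<and>
     (\<exists>U \<rho> \<rho>1 \<rho>2. C2_fun U \<rho> \<rho>1 \<rho>2 \<and> frontier D \<subseteq> U \<and>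
        D \<inter> U = {q\<in>U. \<rho> q < 0} \<and> (\<forall>q\<in>frontier D. levi_pos_at \<rho>1 \<rho>2 q))"

text \<open>Strictly pseudoconvex (C^2) real hypersurface of C^2 (a 3-dimensional strictly
  pseudoconvex CR manifold with the induced CR structure).\<close>
definition spsc_hypersurface :: "(complex \<times> complex) set \<Rightarrow> bool" where
  "spsc_hypersurface M \<longleftrightarrow> (\<forall>p\<in>M. \<exists>U \<rho> \<rho>1 \<rho>2. C2_fun U \<rho> \<rho>1 \<rho>2 \<and> p \<in> U \<and>
        M \<inter> U = {q\<in>U. \<rho> q = 0} \<and> (\<forall>q\<in>M \<inter> U. levi_pos_at \<rho>1 \<rho>2 q))"

text \<open>Umbilical point via Chern--Moser normal form: there is a local biholomorphism
  Phi near p with Phi p = 0 carrying M onto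
  Im w = |z|^2 + sum_{k,l>=2} N_kl(Re w) z^k zbar^l,
  with N_lk = conj N_kl and the normalization N_22 = N_23 = N_33 = 0 (dimension 2),
  and N_24(0) = 0.\<close>
definition umbilical :: "(complex \<times> complex) set \<Rightarrow> complex \<times> complex \<Rightarrow> bool" where
  "umbilical M p \<longleftrightarrow>
    (\<exists>U \<Phi> (N :: nat \<Rightarrow> nat \<Rightarrow> real \<Rightarrow> complex).
       p \<in> U \<and> biholo U \<Phi> \<and> \<Phi> p = (0, 0) \<and>
       (\<forall>k l u. (k < 2 \<or> l < 2) \<longrightarrow> N k l u = 0) \<and>
       (\<forall>k l u. N l k u = cnj (N k l u)) \<and>
       (\<forall>u. N 2 2 u = 0 \<and> N 2 3 u = 0 \<and> N 3 3 u = 0) \<and>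
       (\<forall>z w. (z, w) \<in> \<Phi> ` U \<longrightarrow>
          (\<lambda>(k, l). norm (N k l (Re w) * z ^ k * cnj z ^ l)) summable_on UNIV) \<and>
       \<Phi> ` (M \<inter> U) = {(z, w). (z, w) \<in> \<Phi> ` U \<and>
          Im w = (cmod z)\<^sup>2 + Re (infsum (\<lambda>(k, l). N k l (Re w) * z ^ k * cnj z ^ l) UNIV)} \<and>
       N 2 4 0 = 0)"

text \<open>The domain D_eps (log|z| is -infinity at 0, so the axes are excluded).\<close>
definition Deps :: "real \<Rightarrow> (complex \<times> complex) set" where
  "Deps \<epsilon> = {(z, w). z \<noteq> 0 \<and> w \<noteq> 0 \<and> (ln (cmod z))\<^sup>2 + (ln (cmod w))\<^sup>2 < \<epsilon>\<^sup>2}"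

end

theory Submission
  imports Defs "HOL-Complex_Analysis.Complex_Analysis"
begin

text \<open>
  In the logarithmic coordinates \<open>X = log z\<close>, \<open>Y = log w\<close> the boundary is the tube over a circle,
  \<open>(Re X)\<^sup>2 + (Re Y)\<^sup>2 = \<epsilon>\<^sup>2\<close>, that is \<open>|P + cnj Q| = 2 \<epsilon>\<close> for \<open>P = X + \<i> Y\<close>, \<open>Q = X - \<i> Y\<close>. Its
  Segre varieties are therefore the hyperbolas \<open>(P + a) (Q + b) = 4 \<epsilon>\<^sup>2\<close>.
  In a Chern--Moser normal form the Segre varieties through the origin are
  \<open>w = 2 \<i> \<zeta> z + 2 \<i> n(\<zeta>) z\<^sup>2 + O(z\<^sup>3)\<close> with \<open>n(\<zeta>) = \<Sum>\<^sub>l N\<^sub>2\<^sub>l(0) \<zeta>\<^sup>l\<close>, and \<open>n(\<zeta>) = O(\<zeta>\<^sup>5)\<close> at an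
  umbilical point. Computing \<open>P\<close> and \<open>Q\<close> to second order along these curves and imposing the
  curvature of the hyperbolas gives \<open>4 \<epsilon>\<^sup>2 D(\<zeta>)\<^sup>2 = - S(\<zeta>)\<^sup>3 + O(\<zeta>\<^sup>5)\<close> with a cubic polynomial \<open>D\<close> and
  a quadratic polynomial \<open>S\<close>. (This is Tresse's invariant: a second order equation
  \<open>y'' = F(x, y, y')\<close> that is flat to this order has \<open>F\<close> cubic in \<open>y'\<close>, whereas for the hyperbolas
  \<open>F\<close> is a multiple of \<open>y'\<^bsup>3/2\<^esup>\<close>.) If \<open>S(0) \<noteq> 0\<close>, comparing the coefficients up to \<open>\<zeta>\<^sup>4\<close> shows that the
  discriminant of \<open>S\<close> vanishes; but that discriminant is a nonzero multiple of the squared Jacobian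
  determinant of the normalizing map.

  The coefficients \<open>N\<^sub>k\<^sub>l\<close> are arbitrary functions of \<open>u = Re w\<close>, possibly discontinuous. Therefore the
  equation of the hypersurface is polarized in \<open>(z, \<zeta>)\<close> for each fixed real \<open>u\<close>, and only identities
  between functions that are visibly holomorphic in \<open>u\<close> are continued to complex \<open>u\<close>.
\<close>

section \<open>Taylor polynomials\<close>

definition has_taylor :: "nat \<Rightarrow> ('a::real_normed_field \<Rightarrow> 'a) \<Rightarrow> 'a poly \<Rightarrow> bool" where
  "has_taylor n f p \<longleftrightarrow> (\<lambda>z. f z - poly p z) \<in> O[nhds 0](\<lambda>z. z ^ n)"

lemma tendsto_zero_of_bigo:
  assumes "f \<in> O[F](g)" "(g \<longlongrightarrow> 0) F" shows "(f \<longlongrightarrow> 0) F"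
proof -
  from assms(1) obtain C where "eventually (\<lambda>x. norm (f x) \<le> C * norm (g x)) F"
    by (elim landau_o.bigE)
  then show ?thesis
    by (rule Lim_null_comparison) (intro tendsto_mult_right_zero tendsto_norm_zero assms(2))
qed

lemma poly_bigo_one: "poly p \<in> O[nhds 0](\<lambda>_. 1 :: 'a::real_normed_field)"
proof (rule bigoI_tendsto)
  show "((\<lambda>z. poly p z / 1) \<longlongrightarrow> poly p 0) (nhds 0)"
    by (auto intro!: tendsto_intros filterlim_ident)
qed auto

lemma poly_bigo_power_iff:
  fixes p :: "'a::real_normed_field poly"
  shows "poly p \<in> O[nhds 0](\<lambda>z. z ^ n) \<longleftrightarrow> (\<forall>i<n. coeff p i = 0)"
proof
  assume "\<forall>i<n. coeff p i = 0"
  then obtain q where "p = monom 1 n * q"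
    by (auto simp flip: monom_1_dvd_iff')
  then have "poly p = (\<lambda>z. z ^ n * poly q z)"
    by (simp add: fun_eq_iff poly_monom)
  moreover have "(\<lambda>z. z ^ n * poly q z) \<in> O[nhds 0](\<lambda>z. z ^ n * 1)"
    by (intro landau_o.big.mult poly_bigo_one) simp
  ultimately show "poly p \<in> O[nhds 0](\<lambda>z. z ^ n)" by simp
next
  assume "poly p \<in> O[nhds 0](\<lambda>z. z ^ n)"
  then have "poly p \<in> O[at 0](\<lambda>z. z ^ n)"
    by (rule landau_o.big.filter_mono[rotated]) (simp add: at_within_def)
  then show "\<forall>i<n. coeff p i = 0"
  proof (induction n arbitrary: p)
    case (Suc n)
    obtain a p' where p: "p = pCons a p'" by (cases p)
    have "((\<lambda>z. z ^ Suc n) \<longlongrightarrow> 0) (at (0::'a))" by (auto intro!: tendsto_eq_intros)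
    from tendsto_zero_of_bigo[OF Suc.prems this]
    have "(poly p \<longlongrightarrow> 0) (at 0)" .
    moreover have "(poly p \<longlongrightarrow> a) (at 0)" by (auto simp: p intro!: tendsto_eq_intros)
    ultimately have a: "a = 0" by (rule LIM_unique[symmetric])
    have "(\<lambda>z. z * poly p' z) \<in> O[at 0](\<lambda>z. z * z ^ n)" using Suc.prems by (simp add: p a)
    then have "poly p' \<in> O[at 0](\<lambda>z. z ^ n)"
      by (subst (asm) landau_o.big.mult_cancel_left) (auto simp: eventually_at_filter)
    from Suc.IH[OF this] show ?case by (auto simp: p a coeff_pCons split: nat.split)
  qed simp
qed

lemma has_taylorI:
  assumes "d > 0" "\<And>z. norm z < d \<Longrightarrow> norm (f z - poly p z) \<le> C * norm z ^ n"
  shows "has_taylor n f p"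
proof -
  have "\<forall>\<^sub>F z in nhds 0. norm (f z - poly p z) \<le> C * norm (z ^ n)"
    using eventually_nhds_ball[OF assms(1), of 0]
    by eventually_elim (simp add: assms(2) norm_power)
  then show ?thesis unfolding has_taylor_def by (rule bigoI)
qed

lemma has_taylor_poly: "has_taylor n (poly p) p"
  by (simp add: has_taylor_def)

lemma has_taylor_const: "has_taylor n (\<lambda>_. a) [:a:]"
  by (simp add: has_taylor_def)

lemma has_taylor_id: "has_taylor n (\<lambda>z. z) [:0, 1:]"
  by (simp add: has_taylor_def)

lemma has_taylor_perturb:
  assumes "has_taylor n f p" "(\<lambda>z. g z - f z) \<in> O[nhds 0](\<lambda>z. z ^ n)"
  shows "has_taylor n g p"
  using sum_in_bigo(1)[OF assms(2) assms(1)[unfolded has_taylor_def]]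
  by (simp add: has_taylor_def)

lemma has_taylor_coeff_cong:
  assumes "has_taylor n f p" "\<And>i. i < n \<Longrightarrow> coeff p i = coeff q i"
  shows "has_taylor n f q"
proof -
  have "poly (p - q) \<in> O[nhds 0](\<lambda>z. z ^ n)"
    using assms(2) by (simp add: poly_bigo_power_iff)
  from sum_in_bigo(1)[OF assms(1)[unfolded has_taylor_def] this]
  show ?thesis by (simp add: has_taylor_def)
qed

lemma has_taylor_cong:
  assumes "has_taylor n f p" "d > 0" "\<And>z. norm z < d \<Longrightarrow> f z = g z"
  shows "has_taylor n g p"
proof -
  have "\<forall>\<^sub>F z in nhds 0. f z - poly p z = g z - poly p z"
    using eventually_nhds_ball[OF assms(2), of 0] by eventually_elim (simp add: assms(3))
  from landau_o.big.in_cong[OF this] show ?thesis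
    using assms(1) by (simp add: has_taylor_def)
qed

lemma has_taylor_unique:
  assumes "has_taylor n f p" "has_taylor n f q" "i < n"
  shows "coeff p i = coeff q i"
proof -
  from sum_in_bigo(2)[OF assms(2,1)[unfolded has_taylor_def]]
  have "poly (p - q) \<in> O[nhds 0](\<lambda>z. z ^ n)" by (simp add: poly_diff[abs_def])
  then show ?thesis using assms(3) by (simp add: poly_bigo_power_iff)
qed

lemma has_taylor_bigo_one:
  assumes "has_taylor n f p" shows "f \<in> O[nhds 0](\<lambda>_. 1)"
proof -
  have "(\<lambda>z. f z - poly p z) \<in> O[nhds 0](\<lambda>_. 1)"
    using landau_o.big_trans[OF assms[unfolded has_taylor_def]] poly_bigo_one[of "monom 1 n"]
    by (simp add: poly_monom[abs_def])
  from sum_in_bigo(1)[OF this poly_bigo_one[of p]] show ?thesis by simp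
qed

lemma has_taylor_add:
  assumes "has_taylor n f p" "has_taylor n g q"
  shows "has_taylor n (\<lambda>z. f z + g z) (p + q)"
  using sum_in_bigo(1)[OF assms[unfolded has_taylor_def]]
  by (simp add: has_taylor_def algebra_simps)

lemma has_taylor_mult:
  assumes "has_taylor n f p" "has_taylor n g q"
  shows "has_taylor n (\<lambda>z. f z * g z) (p * q)"
proof -
  have "(\<lambda>z. (f z - poly p z) * g z) \<in> O[nhds 0](\<lambda>z. z ^ n * 1)"
    using assms(1) has_taylor_bigo_one[OF assms(2)] unfolding has_taylor_def
    by (rule landau_o.big.mult)
  moreover have "(\<lambda>z. (g z - poly q z) * poly p z) \<in> O[nhds 0](\<lambda>z. z ^ n * 1)"
    using assms(2) poly_bigo_one unfolding has_taylor_def by (rule landau_o.big.mult)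
  ultimately have "(\<lambda>z. (f z - poly p z) * g z + (g z - poly q z) * poly p z)
      \<in> O[nhds 0](\<lambda>z. z ^ n * 1)"
    by (rule sum_in_bigo)
  then show ?thesis by (simp add: has_taylor_def algebra_simps)
qed

lemma has_taylor_cmult: "has_taylor n f p \<Longrightarrow> has_taylor n (\<lambda>z. c * f z) (smult c p)"
  using has_taylor_mult[OF has_taylor_const[of n c]] by fastforce

lemma has_taylor_diff:
  assumes "has_taylor n f p" "has_taylor n g q"
  shows "has_taylor n (\<lambda>z. f z - g z) (p - q)"
  using has_taylor_add[OF assms(1) has_taylor_cmult[OF assms(2), of "-1"]] by simp

lemma has_taylor_power:
  assumes "has_taylor n f p" shows "has_taylor n (\<lambda>z. f z ^ k) (p ^ k)"
  using has_taylor_const[of n 1]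
  by (induction k) (auto intro: has_taylor_mult assms simp: one_pCons)

lemma has_taylor_sum:
  assumes "\<And>i. i \<in> A \<Longrightarrow> has_taylor n (f i) (p i)"
  shows "has_taylor n (\<lambda>z. \<Sum>i\<in>A. f i z) (\<Sum>i\<in>A. p i)"
  using big_sum_in_bigo[of A "\<lambda>i z. f i z - poly (p i) z"] assms
  by (simp add: has_taylor_def poly_sum sum_subtractf)

lemma has_taylor_tendsto:
  assumes "has_taylor n f p" "n > 0" shows "(f \<longlongrightarrow> poly p 0) (nhds 0)"
proof -
  have "((\<lambda>z::'a. z ^ n) \<longlongrightarrow> 0) (nhds 0)"
    using assms(2) by (auto intro!: tendsto_eq_intros filterlim_ident)
  from tendsto_zero_of_bigo[OF assms(1)[unfolded has_taylor_def] this]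
  have "((\<lambda>z. f z - poly p z) \<longlongrightarrow> 0) (nhds 0)" .
  moreover have "(poly p \<longlongrightarrow> poly p 0) (nhds 0)"
    by (auto intro!: tendsto_intros filterlim_ident)
  ultimately show ?thesis using tendsto_add by fastforce
qed

lemma has_taylor_pcompose:
  assumes "has_taylor n f p" shows "has_taylor n (\<lambda>z. poly q (f z)) (pcompose q p)"
proof (induction q)
  case (pCons a q)
  from has_taylor_add[OF has_taylor_const has_taylor_mult[OF assms pCons.IH]]
  show ?case by (simp add: pcompose_pCons)
qed (use has_taylor_const[of n 0] in simp)

lemma has_taylor_compose:
  assumes g: "has_taylor n g q" and f: "has_taylor n f p" and p: "coeff p 0 = 0" and n: "n > 0"
  shows "has_taylor n (\<lambda>z. g (f z)) (pcompose q p)"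
proof (rule has_taylor_perturb[OF has_taylor_pcompose[OF f]])
  have "(\<lambda>z. f z - poly p z) \<in> O[nhds 0](\<lambda>z. z ^ 1 * z ^ (n - 1))"
    using f n by (simp add: has_taylor_def power_eq_if split: if_splits)
  also have "(\<lambda>z. z ^ 1 * z ^ (n - 1)) \<in> O[nhds 0](\<lambda>z. z ^ 1 * (1 :: 'a))"
    using poly_bigo_one[of "monom 1 (n - 1)"]
    by (intro landau_o.big.mult) (auto simp: poly_monom[abs_def])
  finally have "f \<in> O[nhds 0](\<lambda>z. z)"
    using sum_in_bigo(1)[of "\<lambda>z. f z - poly p z" "nhds 0" "\<lambda>z. z" "poly p"]
      poly_bigo_power_iff[of p 1] p by simp
  have "filterlim f (nhds 0) (nhds 0)"
    using has_taylor_tendsto[OF f n] p by (simp add: poly_0_coeff_0)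
  then have "(\<lambda>z. g (f z) - poly q (f z)) \<in> O[nhds 0](\<lambda>z. f z ^ n)"
    by (rule landau_o.big.compose[OF g[unfolded has_taylor_def]])
  also have "(\<lambda>z. f z ^ n) \<in> O[nhds 0](\<lambda>z. z ^ n)"
    using \<open>f \<in> O[nhds 0](\<lambda>z. z)\<close> by (rule landau_o.big_power)
  finally show "(\<lambda>z. g (f z) - poly q (f z)) \<in> O[nhds 0](\<lambda>z. z ^ n)" .
qed

definition taylor_coeff :: "(complex \<Rightarrow> complex) \<Rightarrow> complex \<Rightarrow> nat \<Rightarrow> complex" where
  "taylor_coeff f u k = (deriv ^^ k) f u / fact k"

lemma taylor_coeff_0 [simp]: "taylor_coeff f u 0 = f u"
  by (simp add: taylor_coeff_def)

lemma norm_taylor_coeff_le: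
  assumes "f holomorphic_on ball u r" "continuous_on (cball u r) f" "r > 0"
    and "\<And>x. x \<in> cball u r \<Longrightarrow> norm (f x) \<le> B"
  shows "norm (taylor_coeff f u k) \<le> B / r ^ k"
proof -
  have "norm ((deriv ^^ k) f u) \<le> fact k * B / r ^ k"
    using assms by (intro Cauchy_inequality) (auto simp: dist_norm)
  then have "norm ((deriv ^^ k) f u) / fact k \<le> fact k * B / r ^ k / fact k"
    by (rule divide_right_mono) simp
  then show ?thesis by (simp add: taylor_coeff_def norm_divide)
qed

lemma taylor_remainder_le:
  assumes hol: "f holomorphic_on ball u r" and cont: "continuous_on (cball u r) f" and r: "r > 0"
    and B: "\<And>x. x \<in> cball u r \<Longrightarrow> norm (f x) \<le> B" and z: "norm (z - u) \<le> r / 2"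
  shows "norm (f z - (\<Sum>i<n. taylor_coeff f u i * (z - u) ^ i)) \<le> 2 * B / r ^ n * norm (z - u) ^ n"
proof -
  let ?a = "\<lambda>i. taylor_coeff f u i * (z - u) ^ i" and ?q = "norm (z - u) / r"
  have q: "0 \<le> ?q" "?q \<le> 1 / 2" "norm ?q < 1" using z r by (auto simp: field_simps)
  have "norm (f u) \<le> B" using B r by simp
  then have "0 \<le> B" using norm_ge_zero order_trans by blast
  have term_le: "norm (?a (i + n)) \<le> B * ?q ^ n * ?q ^ i" for i
  proof -
    have "norm (?a (i + n)) \<le> B / r ^ (i + n) * norm (z - u) ^ (i + n)"
      unfolding norm_mult norm_power
      by (intro mult_right_mono norm_taylor_coeff_le[OF hol cont r B]) auto
    then show ?thesis by (simp add: power_divide power_add mult_ac)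
  qed
  have "?a sums f z"
    using holomorphic_power_series[OF hol, of z] z r
    by (auto simp: taylor_coeff_def dist_norm norm_minus_commute)
  then have tail: "(\<lambda>i. ?a (i + n)) sums (f z - (\<Sum>i<n. ?a i))"
    by (rule sums_split_initial_segment)
  have geometric: "(\<lambda>i. B * ?q ^ n * ?q ^ i) sums (B * ?q ^ n * (1 / (1 - ?q)))"
    using q by (intro sums_mult geometric_sums) simp
  have "norm (f z - (\<Sum>i<n. ?a i)) \<le> B * ?q ^ n * (1 / (1 - ?q))"
    by (rule norm_sums_le[OF tail geometric term_le])
  also have "\<dots> \<le> B * ?q ^ n * 2"
    using q \<open>0 \<le> B\<close> by (intro mult_left_mono) (auto simp: divide_le_eq)
  finally show ?thesis by (simp add: power_divide mult_ac)
qed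

lemma has_taylor_holomorphic:
  assumes "f holomorphic_on S" "open S" "u \<in> S"
  shows "has_taylor n (\<lambda>t. f (u + t)) (\<Sum>i<n. monom (taylor_coeff f u i) i)"
proof -
  obtain r where r: "r > 0" "cball u r \<subseteq> S" using assms(2,3) open_contains_cball by blast
  from r(2) assms(1) have "f holomorphic_on cball u r" by (rule holomorphic_on_subset[rotated])
  then have hol: "f holomorphic_on ball u r" and cont: "continuous_on (cball u r) f"
    by (auto elim: holomorphic_on_subset intro: holomorphic_on_imp_continuous_on)
  have "bounded (f ` cball u r)"
    using cont by (intro compact_imp_bounded compact_continuous_image) auto
  then obtain B where B: "\<And>x. x \<in> cball u r \<Longrightarrow> norm (f x) \<le> B"
    unfolding bounded_iff by blast
  show ?thesis
  proof (rule has_taylorI)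
    show "norm (f (u + t) - poly (\<Sum>i<n. monom (taylor_coeff f u i) i) t) \<le> 2 * B / r ^ n * norm t ^ n"
      if "norm t < r / 2" for t
      using taylor_remainder_le[OF hol cont r(1) B, of "u + t" n] that
      by (simp add: poly_sum poly_monom)
  qed (use r(1) in simp)
qed

lemma DERIV_taylor_coeff:
  assumes "f holomorphic_on S" "open S" "u \<in> S"
  shows "((\<lambda>u. taylor_coeff f u k) has_field_derivative
    of_nat (Suc k) * taylor_coeff f u (Suc k)) (at u)"
proof -
  have "((deriv ^^ k) f has_field_derivative (deriv ^^ Suc k) f u) (at u)"
    using assms by (auto intro!: holomorphic_derivI holomorphic_higher_deriv)
  from DERIV_cdivide[OF this, of "fact k"] show ?thesis
    by (simp add: taylor_coeff_def del: of_nat_Suc)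
qed

lemma has_taylor3_holomorphic:
  assumes f: "f holomorphic_on T" "open T" "u \<in> T" and w: "has_taylor 3 w [:0, w1, w2:]"
  defines "c \<equiv> taylor_coeff f u"
  shows "has_taylor 3 (\<lambda>z. f (u + w z)) [:c 0, c 1 * w1, c 1 * w2 + c 2 * w1\<^sup>2:]"
proof (rule has_taylor_coeff_cong[OF has_taylor_compose[OF has_taylor_holomorphic[OF f] w]])
  fix i :: nat assume "i < 3"
  then consider "i = 0" | "i = 1" | "i = 2" by linarith
  then show "coeff ((\<Sum>i<3. monom (taylor_coeff f u i) i) \<circ>\<^sub>p [:0, w1, w2:]) i
      = coeff [:c 0, c 1 * w1, c 1 * w2 + c 2 * w1\<^sup>2:] i"
    by cases (simp_all add: c_def eval_nat_numeral monom_Suc monom_0 pcompose_pCons algebra_simps)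
qed auto

lemma DERIV_zero_of_constant_on:
  assumes "(f has_field_derivative D) (at x)" "open S" "x \<in> S" "\<And>y. y \<in> S \<Longrightarrow> f y = c"
  shows "D = 0"
proof -
  have "((\<lambda>_. c) has_field_derivative D) (at x)"
    using assms by (rule has_field_derivative_transform_within_open)
  then show ?thesis using DERIV_unique DERIV_const by blast
qed

lemma holomorphic_on_locally_uniform_limit:
  assumes S: "open S" and F: "F \<noteq> bot" and hol: "eventually (\<lambda>n. f n holomorphic_on S) F"
    and lim: "\<And>x. x \<in> S \<Longrightarrow> \<exists>d>0. cball x d \<subseteq> S \<and> uniform_limit (cball x d) f g F"
  shows "g holomorphic_on S"
  unfolding holomorphic_on_open[OF S]
proof
  fix x assume "x \<in> S"
  then obtain d where d: "d > 0" "cball x d \<subseteq> S" "uniform_limit (cball x d) f g F"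
    using lim by blast
  have "eventually (\<lambda>n. continuous_on (cball x d) (f n) \<and> f n holomorphic_on ball x d) F"
    using hol by eventually_elim
      (meson d(2) ball_subset_cball holomorphic_on_imp_continuous_on holomorphic_on_subset)
  then have "g holomorphic_on ball x d"
    by (rule holomorphic_uniform_limit[OF _ d(3) F])
  then show "\<exists>f'. (g has_field_derivative f') (at x)"
    using d(1) holomorphic_derivI[of g "ball x d" x] by auto
qed

section \<open>Holomorphic functions of two variables\<close>

text \<open>For open \<open>D\<close> this is Frechet holomorphy by Osgood's lemma; testing along holomorphic curves
  makes it visibly stable under composition and uniform limits.\<close>

definition holomorphic2_on :: "(complex \<times> complex \<Rightarrow> complex) \<Rightarrow> (complex \<times> complex) set \<Rightarrow> bool"
    (infixl "holomorphic2'_on" 50) where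
  "f holomorphic2_on D \<longleftrightarrow> continuous_on D f \<and>
    (\<forall>S p q. open S \<longrightarrow> p holomorphic_on S \<longrightarrow> q holomorphic_on S \<longrightarrow> (\<forall>t\<in>S. (p t, q t) \<in> D) \<longrightarrow>
      (\<lambda>t. f (p t, q t)) holomorphic_on S)"

lemma holomorphic2_onI:
  assumes "continuous_on D f"
    and "\<And>S p q. open S \<Longrightarrow> p holomorphic_on S \<Longrightarrow> q holomorphic_on S \<Longrightarrow>
      (\<And>t. t \<in> S \<Longrightarrow> (p t, q t) \<in> D) \<Longrightarrow> (\<lambda>t. f (p t, q t)) holomorphic_on S"
  shows "f holomorphic2_on D"
  using assms unfolding holomorphic2_on_def by blast

lemma holomorphic2_on_curve:
  assumes "f holomorphic2_on D" "open S" "p holomorphic_on S" "q holomorphic_on S"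
    "\<And>t. t \<in> S \<Longrightarrow> (p t, q t) \<in> D"
  shows "(\<lambda>t. f (p t, q t)) holomorphic_on S"
  using assms unfolding holomorphic2_on_def by blast

lemma holomorphic2_on_imp_continuous_on: "f holomorphic2_on D \<Longrightarrow> continuous_on D f"
  by (simp add: holomorphic2_on_def)

lemma holomorphic2_on_subset:
  assumes "f holomorphic2_on D" "E \<subseteq> D" shows "f holomorphic2_on E"
proof (rule holomorphic2_onI)
  show "continuous_on E f"
    using assms continuous_on_subset holomorphic2_on_imp_continuous_on by blast
qed (use assms in \<open>auto intro!: holomorphic2_on_curve[OF assms(1)]\<close>)

lemma holomorphic2_on_const: "(\<lambda>_. c) holomorphic2_on D"
  by (rule holomorphic2_onI) auto

lemma holomorphic2_on_fst: "fst holomorphic2_on D"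
  by (rule holomorphic2_onI) (auto intro: continuous_intros)

lemma holomorphic2_on_snd: "snd holomorphic2_on D"
  by (rule holomorphic2_onI) (auto intro: continuous_intros)

lemma holomorphic2_on_add:
  assumes "f holomorphic2_on D" "g holomorphic2_on D" shows "(\<lambda>x. f x + g x) holomorphic2_on D"
  by (rule holomorphic2_onI)
    (auto intro!: continuous_on_add holomorphic_on_add assms[THEN holomorphic2_on_imp_continuous_on]
      assms[THEN holomorphic2_on_curve])

lemma holomorphic2_on_mult:
  assumes "f holomorphic2_on D" "g holomorphic2_on D" shows "(\<lambda>x. f x * g x) holomorphic2_on D"
  by (rule holomorphic2_onI)
    (auto intro!: continuous_on_mult holomorphic_on_mult assms[THEN holomorphic2_on_imp_continuous_on]
      assms[THEN holomorphic2_on_curve])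

lemma holomorphic2_on_diff:
  assumes "f holomorphic2_on D" "g holomorphic2_on D" shows "(\<lambda>x. f x - g x) holomorphic2_on D"
  using holomorphic2_on_add[OF assms(1)
      holomorphic2_on_mult[OF holomorphic2_on_const[of "-1"] assms(2)]]
  by simp

lemma holomorphic2_on_power:
  assumes "f holomorphic2_on D" shows "(\<lambda>x. f x ^ n) holomorphic2_on D"
  by (induction n) (auto intro: holomorphic2_on_const holomorphic2_on_mult assms)

lemma holomorphic2_on_sum:
  assumes "\<And>i. i \<in> A \<Longrightarrow> f i holomorphic2_on D" shows "(\<lambda>x. \<Sum>i\<in>A. f i x) holomorphic2_on D"
  using assms
  by (induction A rule: infinite_finite_induct) (auto intro: holomorphic2_on_const holomorphic2_on_add)

lemma holomorphic2_on_compose: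
  assumes "f holomorphic2_on D" "g holomorphic_on T" "\<And>x. x \<in> D \<Longrightarrow> f x \<in> T"
  shows "(\<lambda>x. g (f x)) holomorphic2_on D"
proof (rule holomorphic2_onI)
  show "continuous_on D (\<lambda>x. g (f x))"
    by (rule continuous_on_compose2[OF holomorphic_on_imp_continuous_on[OF assms(2)]])
      (use assms in \<open>auto intro: holomorphic2_on_imp_continuous_on\<close>)
  show "(\<lambda>t. g (f (p t, q t))) holomorphic_on S"
    if "open S" "p holomorphic_on S" "q holomorphic_on S" "\<And>t. t \<in> S \<Longrightarrow> (p t, q t) \<in> D" for S p q
    using holomorphic_on_compose_gen[OF holomorphic2_on_curve[OF assms(1) that] assms(2)]
      that(4) assms(3)
    by (auto simp: o_def)
qed

lemma holomorphic2_on_Pair: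
  assumes "f holomorphic2_on D" "g holomorphic2_on E" "h holomorphic2_on E"
    and "\<And>x. x \<in> E \<Longrightarrow> (g x, h x) \<in> D"
  shows "(\<lambda>x. f (g x, h x)) holomorphic2_on E"
proof (rule holomorphic2_onI)
  show "continuous_on E (\<lambda>x. f (g x, h x))"
    by (rule continuous_on_compose2[OF holomorphic2_on_imp_continuous_on[OF assms(1)]])
      (use assms in \<open>auto intro!: continuous_on_Pair holomorphic2_on_imp_continuous_on\<close>)
qed (use assms in \<open>auto intro!: holomorphic2_on_curve[OF assms(1)]
      holomorphic2_on_curve[OF assms(2)] holomorphic2_on_curve[OF assms(3)]\<close>)

lemma holomorphic2_on_uniform_limit:
  assumes F: "F \<noteq> bot" and lim: "uniform_limit D f g F" and hol: "\<And>n. f n holomorphic2_on D"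
  shows "g holomorphic2_on D"
proof (rule holomorphic2_onI)
  have "\<forall>\<^sub>F n in F. continuous_on D (f n)"
    using hol by (intro always_eventually allI holomorphic2_on_imp_continuous_on)
  then show "continuous_on D g" using lim F by (rule uniform_limit_theorem)
  show "(\<lambda>t. g (p t, q t)) holomorphic_on S"
    if S: "open S" and hol_pq: "p holomorphic_on S" "q holomorphic_on S"
      and in_D: "\<And>t. t \<in> S \<Longrightarrow> (p t, q t) \<in> D" for S p q
  proof (rule holomorphic_on_locally_uniform_limit[OF S F])
    fix x assume "x \<in> S"
    then obtain d where d: "d > 0" "cball x d \<subseteq> S" using S open_contains_cball by blast
    have "uniform_limit S (\<lambda>n t. f n (p t, q t)) (\<lambda>t. g (p t, q t)) F"
      using in_D by (intro uniform_limit_compose'[OF lim]) auto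
    then have "uniform_limit (cball x d) (\<lambda>n t. f n (p t, q t)) (\<lambda>t. g (p t, q t)) F"
      using d(2) by (rule uniform_limit_on_subset)
    with d show "\<exists>d>0. cball x d \<subseteq> S \<and>
        uniform_limit (cball x d) (\<lambda>n t. f n (p t, q t)) (\<lambda>t. g (p t, q t)) F" by blast
  next
    show "\<forall>\<^sub>F n in F. (\<lambda>t. f n (p t, q t)) holomorphic_on S"
      using holomorphic2_on_curve[OF hol S hol_pq in_D] by simp
  qed
qed

definition reflect :: "(complex \<times> complex \<Rightarrow> complex) \<Rightarrow> complex \<times> complex \<Rightarrow> complex" where
  "reflect f x = cnj (f (cnj (fst x), cnj (snd x)))"

lemma holomorphic2_on_reflect:
  assumes "f holomorphic2_on D" "\<And>x. x \<in> E \<Longrightarrow> (cnj (fst x), cnj (snd x)) \<in> D"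
  shows "reflect f holomorphic2_on E"
proof (rule holomorphic2_onI)
  show "continuous_on E (reflect f)"
    unfolding reflect_def
    by (intro continuous_on_cnj
        continuous_on_compose2[OF holomorphic2_on_imp_continuous_on[OF assms(1)]])
      (use assms(2) in \<open>auto intro!: continuous_intros\<close>)
next
  fix S p q assume S: "open S" and pq: "p holomorphic_on S" "q holomorphic_on S"
    and E: "\<And>t. t \<in> S \<Longrightarrow> (p t, q t) \<in> E"
  have S': "open (cnj ` S)"
    unfolding image_cnj_conv_vimage_cnj using S by (intro open_vimage continuous_intros)
  have "(\<lambda>t. f ((cnj \<circ> p \<circ> cnj) t, (cnj \<circ> q \<circ> cnj) t)) holomorphic_on cnj ` S"
  proof (rule holomorphic2_on_curve[OF assms(1) S'])
    show "((cnj \<circ> p \<circ> cnj) t, (cnj \<circ> q \<circ> cnj) t) \<in> D" if "t \<in> cnj ` S" for t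
      using that assms(2) E by fastforce
  qed (intro holomorphic_on_compose_cnj_cnj S'; simp add: pq image_image)+
  from holomorphic_on_compose_cnj_cnj[OF this S]
  show "(\<lambda>t. reflect f (p t, q t)) holomorphic_on S"
    by (simp add: reflect_def o_def)
qed

abbreviation bidisc :: "real \<Rightarrow> (complex \<times> complex) set" where
  "bidisc r \<equiv> ball 0 r \<times> ball 0 r"

lemma reflect_holomorphic2_on_bidisc: "F holomorphic2_on bidisc r \<Longrightarrow> reflect F holomorphic2_on bidisc r"
  by (rule holomorphic2_on_reflect) auto

lemma open_contains_bidisc:
  fixes W :: "(complex \<times> complex) set"
  assumes "open W" "(0, 0) \<in> W"
  obtains \<delta> where "\<delta> > 0" "cball 0 \<delta> \<times> cball 0 \<delta> \<subseteq> W"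
proof -
  obtain A B where AB: "open A" "open B" "(0, 0) \<in> A \<times> B" "A \<times> B \<subseteq> W"
    by (rule open_prod_elim[OF assms])
  obtain a where "a > 0" "cball 0 a \<subseteq> A" using AB(1,3) open_contains_cball by blast
  moreover obtain b where "b > 0" "cball 0 b \<subseteq> B" using AB(2,3) open_contains_cball by blast
  ultimately have ab: "min a b > 0" "cball 0 (min a b) \<subseteq> A" "cball 0 (min a b) \<subseteq> B" by auto
  from Sigma_mono[OF ab(2,3)] AB(4) have "cball 0 (min a b) \<times> cball 0 (min a b) \<subseteq> W"
    by (rule order_trans)
  with ab(1) show thesis by (rule that)
qed

lemmas holomorphic2_intros =
  holomorphic2_on_const holomorphic2_on_fst holomorphic2_on_snd holomorphic2_on_add
  holomorphic2_on_diff holomorphic2_on_mult holomorphic2_on_power holomorphic2_on_sum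

lemma holomorphic2_on_slice1:
  assumes "f holomorphic2_on S \<times> T" "open S" "w \<in> T" shows "(\<lambda>z. f (z, w)) holomorphic_on S"
  by (rule holomorphic2_on_curve[OF assms(1,2)]) (use assms(3) in auto)

lemma holomorphic2_on_slice2:
  assumes "f holomorphic2_on S \<times> T" "open T" "z \<in> S" shows "(\<lambda>w. f (z, w)) holomorphic_on T"
  by (rule holomorphic2_on_curve[OF assms(1,2)]) (use assms(3) in auto)

lemma holomorphic2_on_taylor_remainder:
  assumes f: "f holomorphic2_on ball a r \<times> T" and K: "compact K" "K \<subseteq> T" and \<rho>: "0 < \<rho>" "\<rho> < r"
  obtains B where "\<And>n z w. z \<in> cball a (\<rho> / 2) \<Longrightarrow> w \<in> K \<Longrightarrow>
    norm (f (z, w) - (\<Sum>i<n. taylor_coeff (\<lambda>z. f (z, w)) a i * (z - a) ^ i))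
      \<le> B / \<rho> ^ n * norm (z - a) ^ n"
proof -
  have "continuous_on (cball a \<rho> \<times> K) f"
    by (rule continuous_on_subset[OF holomorphic2_on_imp_continuous_on[OF f]]) (use K \<rho> in auto)
  then have "bounded (f ` (cball a \<rho> \<times> K))"
    using K by (intro compact_imp_bounded compact_continuous_image compact_Times) auto
  then obtain B where B: "norm (f (z, w)) \<le> B" if "z \<in> cball a \<rho>" "w \<in> K" for z w
    unfolding bounded_iff by blast
  have "norm (f (z, w) - (\<Sum>i<n. taylor_coeff (\<lambda>z. f (z, w)) a i * (z - a) ^ i))
      \<le> 2 * B / \<rho> ^ n * norm (z - a) ^ n" if z: "z \<in> cball a (\<rho> / 2)" and w: "w \<in> K" for n z w
  proof (rule taylor_remainder_le)
    have hol: "(\<lambda>z. f (z, w)) holomorphic_on ball a r"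
      using w K by (intro holomorphic2_on_slice1[OF f]) auto
    then show "(\<lambda>z. f (z, w)) holomorphic_on ball a \<rho>" "continuous_on (cball a \<rho>) (\<lambda>z. f (z, w))"
      using \<rho> by (auto intro!: holomorphic_on_imp_continuous_on elim!: holomorphic_on_subset)
  qed (use B z w \<rho> in \<open>auto simp: dist_norm norm_minus_commute\<close>)
  then show thesis by (rule that)
qed

lemma taylor_quotient_error_le:
  fixes h y :: "'a::real_normed_field"
  assumes "h \<noteq> 0" "norm (y - (\<Sum>i<Suc k. c i * h ^ i)) \<le> C * norm h ^ Suc k"
  shows "norm ((y - (\<Sum>i<k. c i * h ^ i)) / h ^ k - c k) \<le> C * norm h"
proof -
  have "(y - (\<Sum>i<k. c i * h ^ i)) / h ^ k - c k = (y - (\<Sum>i<Suc k. c i * h ^ i)) / h ^ k"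
    using assms(1) by (simp add: diff_divide_distrib add_divide_distrib)
  then have "norm ((y - (\<Sum>i<k. c i * h ^ i)) / h ^ k - c k) =
      norm (y - (\<Sum>i<Suc k. c i * h ^ i)) / norm h ^ k"
    by (simp add: norm_divide norm_power)
  also have "\<dots> \<le> C * norm h ^ Suc k / norm h ^ k"
    using assms(2) by (rule divide_right_mono) simp
  finally show ?thesis using assms(1) by simp
qed

lemma uniform_limit_at_0_linear_rate:
  fixes G :: "'a::real_normed_vector \<Rightarrow> 'b \<Rightarrow> 'c::real_normed_vector"
  assumes d: "d > 0"
    and rate: "\<And>h w. h \<noteq> 0 \<Longrightarrow> norm h < d \<Longrightarrow> w \<in> S \<Longrightarrow> norm (G h w - g w) \<le> C * norm h"
  shows "uniform_limit S G g (at 0)"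
proof (rule uniform_limitI)
  fix e :: real assume "e > 0"
  have "((\<lambda>h::'a. C * norm h) \<longlongrightarrow> 0) (at 0)" by (auto intro!: tendsto_eq_intros)
  then have "\<forall>\<^sub>F h::'a in at 0. C * norm h < e"
    using \<open>e > 0\<close> by (rule order_tendstoD)
  moreover have "\<forall>\<^sub>F h::'a in at 0. norm h < d \<and> h \<noteq> 0"
    using eventually_at_ball'[OF d, of "0::'a" UNIV] by (simp add: dist_norm)
  ultimately show "\<forall>\<^sub>F h in at 0. \<forall>w\<in>S. dist (G h w) (g w) < e"
    by eventually_elim (use rate in \<open>fastforce simp: dist_norm\<close>)
qed

lemma holomorphic_on_taylor_coeff:
  assumes f: "f holomorphic2_on ball a r \<times> T" and r: "r > 0" and T: "open T"
  shows "(\<lambda>w. taylor_coeff (\<lambda>z. f (z, w)) a k) holomorphic_on T"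
proof (induction k rule: less_induct)
  case (less k)
  define c where "c i w = taylor_coeff (\<lambda>z. f (z, w)) a i" for i w
  define G where "G h w = (f (a + h, w) - (\<Sum>i<k. c i w * h ^ i)) / h ^ k" for h w
  have "c k holomorphic_on T"
  proof (rule holomorphic_on_locally_uniform_limit[OF T, of "at 0"])
    have "eventually (\<lambda>h. norm h < r \<and> h \<noteq> 0) (at (0::complex))"
      using eventually_at_ball'[OF r, of "0::complex" UNIV] by (simp add: dist_norm)
    then show "\<forall>\<^sub>F h in at 0. G h holomorphic_on T"
    proof eventually_elim
      case (elim h)
      then show ?case
        unfolding G_def c_def
        by (intro holomorphic_intros holomorphic2_on_slice2[OF f T] less.IH) (auto simp: dist_norm)
    qed
  next
    fix x assume "x \<in> T"
    then obtain d where d: "d > 0" "cball x d \<subseteq> T" using T open_contains_cball by blast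
    define \<rho> where "\<rho> = r / 2"
    have \<rho>: "0 < \<rho>" "\<rho> < r" using r by (auto simp: \<rho>_def)
    obtain B where B: "\<And>n z w. z \<in> cball a (\<rho> / 2) \<Longrightarrow> w \<in> cball x d \<Longrightarrow>
        norm (f (z, w) - (\<Sum>i<n. c i w * (z - a) ^ i)) \<le> B / \<rho> ^ n * norm (z - a) ^ n"
      unfolding c_def by (rule holomorphic2_on_taylor_remainder[OF f _ d(2) \<rho>]) auto
    have rate: "norm (G h w - c k w) \<le> B / \<rho> ^ Suc k * norm h"
      if "h \<noteq> 0" "norm h < \<rho> / 2" "w \<in> cball x d" for h w
      unfolding G_def using that B[of "a + h" w "Suc k"]
      by (intro taylor_quotient_error_le) (auto simp: dist_norm)
    have "uniform_limit (cball x d) G (c k) (at 0)"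
      by (rule uniform_limit_at_0_linear_rate[where d = "\<rho> / 2", OF _ rate]) (use \<rho> in auto)
    then show "\<exists>d>0. cball x d \<subseteq> T \<and> uniform_limit (cball x d) G (c k) (at 0)" using d by blast
  qed simp
  then show ?case by (simp add: c_def[abs_def])
qed

definition taylor2_coeff :: "(complex \<times> complex \<Rightarrow> complex) \<Rightarrow> complex \<Rightarrow> nat \<Rightarrow> nat \<Rightarrow> complex" where
  "taylor2_coeff f u k l = taylor_coeff (\<lambda>w. taylor_coeff (\<lambda>z. f (z, w)) 0 k) u l"

lemma DERIV_taylor2_coeff:
  assumes "f holomorphic2_on ball 0 r \<times> T" "r > 0" "open T" "u \<in> T"
  shows "((\<lambda>u. taylor2_coeff f u k l) has_field_derivative
    of_nat (Suc l) * taylor2_coeff f u k (Suc l)) (at u)"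
  unfolding taylor2_coeff_def using assms
  by (intro DERIV_taylor_coeff holomorphic_on_taylor_coeff)

lemma holomorphic_on_taylor2_coeff:
  assumes "f holomorphic2_on ball 0 r \<times> T" "r > 0" "open T"
  shows "(\<lambda>u. taylor2_coeff f u k l) holomorphic_on T"
  unfolding holomorphic_on_open[OF assms(3)] using DERIV_taylor2_coeff[OF assms] by blast

lemma taylor2_coeff_partials:
  "taylor2_coeff f 0 1 0 = deriv (\<lambda>z. f (z, 0)) 0" "taylor2_coeff f 0 0 1 = deriv (\<lambda>w. f (0, w)) 0"
  by (simp_all add: taylor2_coeff_def taylor_coeff_def)

lemma has_taylor_holomorphic2:
  assumes f: "f holomorphic2_on ball 0 r \<times> T" and r: "r > 0" and T: "open T" and u: "u \<in> T"
    and w: "has_taylor n w p" "coeff p 0 = 0" and n: "n > 0"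
  shows "has_taylor n (\<lambda>z. f (z, u + w z))
    (\<Sum>k<n. monom 1 k * pcompose (\<Sum>l<n. monom (taylor2_coeff f u k l) l) p)"
proof -
  define c where "c k w = taylor_coeff (\<lambda>z. f (z, w)) 0 k" for k w
  have "has_taylor n (\<lambda>z. c k (u + w z)) (pcompose (\<Sum>l<n. monom (taylor2_coeff f u k l) l) p)" for k
    unfolding taylor2_coeff_def c_def
    by (intro has_taylor_compose has_taylor_holomorphic[OF _ T u]
        holomorphic_on_taylor_coeff[OF f r T] w n)
  then have main: "has_taylor n (\<lambda>z. \<Sum>k<n. z ^ k * c k (u + w z))
      (\<Sum>k<n. monom 1 k * pcompose (\<Sum>l<n. monom (taylor2_coeff f u k l) l) p)"
    using has_taylor_poly[of n "monom 1 _"]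
    by (intro has_taylor_sum has_taylor_mult) (auto simp: poly_monom[abs_def])
  obtain d where d: "d > 0" "cball u d \<subseteq> T" using T u open_contains_cball by blast
  define \<rho> where "\<rho> = r / 2"
  have \<rho>: "0 < \<rho>" "\<rho> < r" using r by (auto simp: \<rho>_def)
  obtain B where B: "\<And>n z w. z \<in> cball 0 (\<rho> / 2) \<Longrightarrow> w \<in> cball u d \<Longrightarrow>
      norm (f (z, w) - (\<Sum>i<n. c i w * (z - 0) ^ i)) \<le> B / \<rho> ^ n * norm (z - 0) ^ n"
    unfolding c_def by (rule holomorphic2_on_taylor_remainder[OF f _ d(2) \<rho>]) auto
  have "(w \<longlongrightarrow> 0) (nhds 0)" using has_taylor_tendsto[OF w(1) n] w(2) by (simp add: poly_0_coeff_0)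
  then have "\<forall>\<^sub>F z in nhds 0. w z \<in> ball 0 d"
    using d(1) by (intro topological_tendstoD) auto
  moreover have "\<forall>\<^sub>F z in nhds 0. z \<in> ball 0 (\<rho> / 2)"
    using \<rho> by (intro eventually_nhds_ball) simp
  ultimately have "\<forall>\<^sub>F z in nhds 0. norm (f (z, u + w z) - (\<Sum>k<n. z ^ k * c k (u + w z)))
      \<le> B / \<rho> ^ n * norm (z ^ n)"
  proof eventually_elim
    case (elim z)
    then show ?case using B[of z "u + w z" n] by (simp add: dist_norm norm_power mult.commute)
  qed
  then show ?thesis by (intro has_taylor_perturb[OF main] bigoI)
qed

lemma has_taylor3_holomorphic2:
  assumes f: "f holomorphic2_on ball 0 r \<times> T" "r > 0" "open T" "u \<in> T"
    and w: "has_taylor 3 w [:0, w1, w2:]"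
  defines "c \<equiv> taylor2_coeff f u"
  shows "has_taylor 3 (\<lambda>z. f (z, u + w z))
    [:c 0 0, c 1 0 + c 0 1 * w1, c 2 0 + c 1 1 * w1 + c 0 2 * w1\<^sup>2 + c 0 1 * w2:]"
proof (rule has_taylor_coeff_cong[OF has_taylor_holomorphic2[OF f w]])
  fix i :: nat assume "i < 3"
  then consider "i = 0" | "i = 1" | "i = 2" by linarith
  then show "coeff (\<Sum>k<3. monom 1 k * pcompose (\<Sum>l<3. monom (taylor2_coeff f u k l) l) [:0, w1, w2:]) i
      = coeff [:c 0 0, c 1 0 + c 0 1 * w1, c 2 0 + c 1 1 * w1 + c 0 2 * w1\<^sup>2 + c 0 1 * w2:] i"
    by cases (simp_all add: c_def eval_nat_numeral monom_Suc monom_0 pcompose_pCons algebra_simps)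
qed auto

lemma holomorphic_zero_of_zero_on_reals:
  assumes f: "f holomorphic_on ball 0 r"
    and zero: "\<And>x::real. \<bar>x\<bar> < r \<Longrightarrow> f (of_real x) = 0" and z: "norm z < r"
  shows "f z = 0"
proof (rule analytic_continuation[OF f, where U = "of_real ` {-r<..<r}" and \<xi> = 0])
  have r: "r > 0" using z norm_ge_zero[of z] by linarith
  then show "0 \<in> ball 0 r" by simp
  show "0 islimpt complex_of_real ` {- r<..<r}"
    unfolding islimpt_approachable
  proof (intro allI impI)
    fix e :: real assume "e > 0"
    then show "\<exists>x\<in>complex_of_real ` {- r<..<r}. x \<noteq> 0 \<and> dist x 0 < e"
      using r by (intro bexI[of _ "complex_of_real (min e r / 2)"] imageI) auto
  qed
qed (use zero z in auto)

text \<open>Polarization: the antidiagonal \<open>\<zeta> = cnj z\<close> is totally real, as \<open>z = p + \<i> q\<close>, \<open>\<zeta> = p - \<i> q\<close>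
  with \<open>p\<close>, \<open>q\<close> real shows.\<close>

lemma holomorphic2_zero_of_zero_on_antidiagonal:
  assumes h: "h holomorphic2_on bidisc r" and antidiag: "\<And>z. norm z < r \<Longrightarrow> h (z, cnj z) = 0"
    and z: "norm z < r / 2" "norm \<zeta> < r / 2"
  shows "h (z, \<zeta>) = 0"
proof -
  have in_bidisc: "(p + \<i> * q, p - \<i> * q) \<in> bidisc r" if "norm p < r / 2" "norm q < r / 2" for p q
    using that norm_triangle_ineq[of p "\<i> * q"] norm_triangle_ineq4[of p "\<i> * q"]
    by (auto simp: norm_mult)
  have real_p: "h (of_real p + \<i> * q, of_real p - \<i> * q) = 0"
    if "\<bar>p\<bar> < r / 2" "norm q < r / 2" for p :: real and q
  proof (rule holomorphic_zero_of_zero_on_reals[OF _ _ that(2)])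
    show "(\<lambda>q. h (of_real p + \<i> * q, of_real p - \<i> * q)) holomorphic_on ball 0 (r / 2)"
      by (rule holomorphic2_on_curve[OF h]) (use that(1) in_bidisc in \<open>auto intro!: holomorphic_intros\<close>)
    fix x :: real assume "\<bar>x\<bar> < r / 2"
    then show "h (of_real p + \<i> * of_real x, of_real p - \<i> * of_real x) = 0"
      using antidiag[of "of_real p + \<i> * of_real x"] in_bidisc[of "of_real p" "of_real x"] that(1)
      by simp
  qed
  have "h (p + \<i> * q, p - \<i> * q) = 0" if "norm p < r / 2" "norm q < r / 2" for p q
  proof (rule holomorphic_zero_of_zero_on_reals[OF _ _ that(1)])
    show "(\<lambda>p. h (p + \<i> * q, p - \<i> * q)) holomorphic_on ball 0 (r / 2)"
      by (rule holomorphic2_on_curve[OF h]) (use that(2) in_bidisc in \<open>auto intro!: holomorphic_intros\<close>)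
  qed (use real_p that in auto)
  moreover have "norm ((z + \<zeta>) / 2) < r / 2" "norm ((z - \<zeta>) / (2 * \<i>)) < r / 2"
    using z norm_triangle_ineq[of z \<zeta>] norm_triangle_ineq4[of z \<zeta>]
    by (auto simp: norm_divide norm_mult)
  moreover have "(z + \<zeta>) / 2 + \<i> * ((z - \<zeta>) / (2 * \<i>)) = z"
    "(z + \<zeta>) / 2 - \<i> * ((z - \<zeta>) / (2 * \<i>)) = \<zeta>"
    by (simp_all add: field_simps)
  ultimately show ?thesis by metis
qed

lemma holomorphic2_zero_of_zero_on_real_slices:
  assumes h: "h holomorphic2_on bidisc r"
    and zero: "\<And>u::real. \<bar>u\<bar> < r \<Longrightarrow> \<exists>\<delta>>0. \<forall>\<zeta>. norm \<zeta> < \<delta> \<longrightarrow> h (\<zeta>, of_real u) = 0"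
    and x: "(\<zeta>, u) \<in> bidisc r"
  shows "h (\<zeta>, u) = 0"
proof (rule holomorphic_zero_of_zero_on_reals[where f = "\<lambda>u. h (\<zeta>, u)"])
  show "(\<lambda>u. h (\<zeta>, u)) holomorphic_on ball 0 r"
    by (rule holomorphic2_on_slice2[OF h]) (use x in auto)
  show "norm u < r" using x by simp
  fix v :: real assume v: "\<bar>v\<bar> < r"
  obtain \<delta> where \<delta>: "\<delta> > 0" "\<And>\<zeta>. norm \<zeta> < \<delta> \<Longrightarrow> h (\<zeta>, of_real v) = 0" using zero[OF v] by blast
  have hol: "(\<lambda>\<zeta>. h (\<zeta>, of_real v)) holomorphic_on ball 0 r"
    by (rule holomorphic2_on_slice1[OF h]) (use v in auto)
  show "h (\<zeta>, of_real v) = 0"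
    by (rule analytic_continuation_open[OF _ _ _ _ _ hol, where s = "ball 0 (min \<delta> r)" and g = "\<lambda>_. 0"])
      (use \<delta> x v in auto)
qed

section \<open>Double power series\<close>

definition powser2 :: "(nat \<Rightarrow> nat \<Rightarrow> complex) \<Rightarrow> complex \<Rightarrow> complex \<Rightarrow> complex" where
  "powser2 N z \<zeta> = (\<Sum>\<^sub>\<infinity>(k, l)\<in>UNIV. N k l * z ^ k * \<zeta> ^ l)"

definition powser2_summable :: "real \<Rightarrow> (nat \<Rightarrow> nat \<Rightarrow> complex) \<Rightarrow> bool" where
  "powser2_summable r N \<longleftrightarrow> (\<lambda>(k, l). norm (N k l) * r ^ k * r ^ l) summable_on UNIV"

definition powser2_row :: "(nat \<Rightarrow> nat \<Rightarrow> complex) \<Rightarrow> nat \<Rightarrow> complex \<Rightarrow> complex" where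
  "powser2_row N k \<zeta> = (\<Sum>\<^sub>\<infinity>l. N k l * \<zeta> ^ l)"

lemma norm_powser2_term_le:
  fixes r :: real and a z \<zeta> :: complex
  assumes "norm z \<le> r" "norm \<zeta> \<le> r"
  shows "norm (a * z ^ k * \<zeta> ^ l) \<le> norm a * r ^ k * r ^ l"
proof -
  have "0 \<le> r" using assms norm_ge_zero order_trans by blast
  then show ?thesis unfolding norm_mult norm_power using assms
    by (intro mult_mono power_mono mult_nonneg_nonneg) auto
qed

lemma powser2_abs_summable_on:
  assumes "powser2_summable r N" "norm z \<le> r" "norm \<zeta> \<le> r"
  shows "(\<lambda>kl. norm (case kl of (k, l) \<Rightarrow> N k l * z ^ k * \<zeta> ^ l)) summable_on UNIV"
  by (rule summable_on_comparison_test[OF assms(1)[unfolded powser2_summable_def]])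
    (use norm_powser2_term_le[OF assms(2,3)] in auto)

lemma holomorphic2_on_powser2:
  assumes "powser2_summable r N"
  shows "(\<lambda>x. powser2 N (fst x) (snd x)) holomorphic2_on bidisc r"
proof (rule holomorphic2_on_uniform_limit[where F = "finite_subsets_at_top UNIV"])
  show "uniform_limit (bidisc r) (\<lambda>X x. \<Sum>(k, l)\<in>X. N k l * fst x ^ k * snd x ^ l)
      (\<lambda>x. powser2 N (fst x) (snd x)) (finite_subsets_at_top UNIV)"
    unfolding powser2_def
  proof (rule Weierstrass_m_test_general[OF _ assms[unfolded powser2_summable_def]])
    fix kl :: "nat \<times> nat" and x :: "complex \<times> complex" assume "x \<in> bidisc r"
    then show "norm (case kl of (k, l) \<Rightarrow> N k l * fst x ^ k * snd x ^ l)
        \<le> (case kl of (k, l) \<Rightarrow> norm (N k l) * r ^ k * r ^ l)"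
      using norm_powser2_term_le[of "fst x" r "snd x"] by (auto simp: mem_Times_iff split: prod.split)
  qed
  show "(\<lambda>x. \<Sum>(k, l)\<in>X. N k l * fst x ^ k * snd x ^ l) holomorphic2_on bidisc r" for X
    unfolding case_prod_unfold by (intro holomorphic2_intros)
qed simp

lemma cnj_powser2:
  assumes "\<And>k l. N l k = cnj (N k l)"
  shows "cnj (powser2 N z \<zeta>) = powser2 N (cnj \<zeta>) (cnj z)"
proof -
  let ?f = "\<lambda>(k, l). N k l * cnj \<zeta> ^ k * cnj z ^ l"
  have "cnj (powser2 N z \<zeta>) = (\<Sum>\<^sub>\<infinity>kl\<in>UNIV. ?f (prod.swap kl))"
    unfolding powser2_def infsum_cnj[symmetric]
    by (rule infsum_cong) (auto simp: assms[symmetric] mult_ac)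
  also have "\<dots> = (\<Sum>\<^sub>\<infinity>kl\<in>UNIV. ?f kl)"
    by (rule infsum_reindex_bij_betw) (rule bij_swap)
  finally show ?thesis by (simp add: powser2_def)
qed

lemma powser_remainder_le:
  fixes a :: "nat \<Rightarrow> 'a::{real_normed_field,banach}"
  assumes r: "r > 0" and summable_on: "(\<lambda>k. norm (a k) * r ^ k) summable_on UNIV" and z: "norm z \<le> r"
  shows "norm ((\<Sum>\<^sub>\<infinity>k. a k * z ^ k) - (\<Sum>k<n. a k * z ^ k))
    \<le> (\<Sum>k. norm (a (k + n)) * r ^ (k + n)) / r ^ n * norm z ^ n"
proof -
  have "(\<lambda>k. norm (a k * z ^ k)) summable_on UNIV"
    by (rule summable_on_comparison_test[OF summable_on])
      (use z in \<open>auto simp: norm_mult norm_power intro!: mult_left_mono power_mono\<close>)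
  then have "(\<lambda>k. a k * z ^ k) sums (\<Sum>\<^sub>\<infinity>k. a k * z ^ k)"
    by (intro has_sum_imp_sums has_sum_infsum) (rule abs_summable_summable)
  then have tail: "(\<lambda>k. a (k + n) * z ^ (k + n)) sums ((\<Sum>\<^sub>\<infinity>k. a k * z ^ k) - (\<Sum>k<n. a k * z ^ k))"
    by (rule sums_split_initial_segment)
  have "(\<lambda>k. norm (a (k + n)) * r ^ (k + n)) sums (\<Sum>k. norm (a (k + n)) * r ^ (k + n))"
    using summable_on_imp_summable[OF summable_on]
    by (intro summable_sums summable_ignore_initial_segment)
  then have majorant: "(\<lambda>k. norm z ^ n / r ^ n * (norm (a (k + n)) * r ^ (k + n))) sums
      (norm z ^ n / r ^ n * (\<Sum>k. norm (a (k + n)) * r ^ (k + n)))"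
    by (rule sums_mult)
  have "norm (a (k + n) * z ^ (k + n)) \<le> norm z ^ n / r ^ n * (norm (a (k + n)) * r ^ (k + n))" for k
  proof -
    have "norm z ^ n * (norm (a (k + n)) * norm z ^ k) \<le> norm z ^ n * (norm (a (k + n)) * r ^ k)"
      using z by (intro mult_left_mono power_mono) auto
    then show ?thesis using r by (simp add: norm_mult norm_power power_add mult_ac)
  qed
  from norm_sums_le[OF tail majorant this] show ?thesis by (simp add: mult_ac)
qed

lemma has_taylor_powser:
  fixes a :: "nat \<Rightarrow> 'a::{real_normed_field,banach}"
  assumes "r > 0" "(\<lambda>k. norm (a k) * r ^ k) summable_on UNIV"
  shows "has_taylor n (\<lambda>z. \<Sum>\<^sub>\<infinity>k. a k * z ^ k) (\<Sum>k<n. monom (a k) k)"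
proof (rule has_taylorI[OF assms(1)])
  show "norm ((\<Sum>\<^sub>\<infinity>k. a k * z ^ k) - poly (\<Sum>k<n. monom (a k) k) z)
      \<le> (\<Sum>k. norm (a (k + n)) * r ^ (k + n)) / r ^ n * norm z ^ n" if "norm z < r" for z
    using powser_remainder_le[OF assms, of z n] that by (simp add: poly_sum poly_monom)
qed

lemma has_taylor_powser2_row:
  assumes N: "powser2_summable r N" and r: "r > 0"
  shows "has_taylor n (powser2_row N k) (\<Sum>l<n. monom (N k l) l)"
proof -
  have "(\<lambda>l. r ^ k * (norm (N k l) * r ^ l)) summable_on UNIV"
    using summable_on_SigmaD1[of "\<lambda>k l. norm (N k l) * r ^ k * r ^ l" UNIV "\<lambda>_. UNIV" k] N r
    by (simp add: powser2_summable_def case_prod_unfold mult_ac)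
  then have "(\<lambda>l. norm (N k l) * r ^ l) summable_on UNIV"
    using r by (simp add: summable_on_cmult_right')
  from has_taylor_powser[OF r this] show ?thesis
    by (simp add: powser2_row_def[abs_def])
qed

lemma powser2_eq_infsum_rows:
  assumes "powser2_summable r N" "norm z \<le> r" "norm \<zeta> \<le> r"
  shows "powser2 N z \<zeta> = (\<Sum>\<^sub>\<infinity>k. powser2_row N k \<zeta> * z ^ k)"
proof -
  have row: "(\<Sum>\<^sub>\<infinity>l. N k l * z ^ k * \<zeta> ^ l) = powser2_row N k \<zeta> * z ^ k" for k
    unfolding powser2_row_def by (subst infsum_cmult_left'[symmetric]) (simp add: mult_ac)
  show ?thesis
    using infsum_Sigma'_banach[of "\<lambda>k l. N k l * z ^ k * \<zeta> ^ l" UNIV "\<lambda>_. UNIV"]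
      abs_summable_summable[OF powser2_abs_summable_on[OF assms]]
    by (simp add: powser2_def row)
qed

lemma powser2_rows_summable_on:
  assumes N: "powser2_summable r N" and r: "r > 0" and \<zeta>: "norm \<zeta> \<le> r"
  shows "(\<lambda>k. norm (powser2_row N k \<zeta>) * r ^ k) summable_on UNIV"
proof (rule summable_on_comparison_test)
  let ?f = "\<lambda>k l. N k l * of_real r ^ k * \<zeta> ^ l"
  have "(\<lambda>kl. norm (case kl of (k, l) \<Rightarrow> ?f k l)) summable_on (SIGMA k:UNIV. UNIV)"
    using powser2_abs_summable_on[OF N, of "of_real r" \<zeta>] r \<zeta> by simp
  then have rows: "(\<lambda>l. norm (?f k l)) summable_on UNIV"
    and sum_rows: "(\<lambda>k. norm (\<Sum>\<^sub>\<infinity>l. norm (?f k l))) summable_on UNIV" for k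
    unfolding Infinite_Sum.abs_summable_on_Sigma_iff by simp_all
  show "(\<lambda>k. \<Sum>\<^sub>\<infinity>l. norm (?f k l)) summable_on UNIV"
    using sum_rows by (rule abs_summable_summable)
  show "norm (powser2_row N k \<zeta>) * r ^ k \<le> (\<Sum>\<^sub>\<infinity>l. norm (?f k l))" for k
  proof -
    have "powser2_row N k \<zeta> * of_real r ^ k = (\<Sum>\<^sub>\<infinity>l. ?f k l)"
      unfolding powser2_row_def by (subst infsum_cmult_left'[symmetric]) (simp add: mult_ac)
    from arg_cong[OF this, of norm] have "norm (powser2_row N k \<zeta>) * r ^ k = norm (\<Sum>\<^sub>\<infinity>l. ?f k l)"
      using r by (simp add: norm_mult norm_power)
    then show ?thesis using norm_infsum_bound[OF rows] by simp
  qed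
qed (use r in auto)

lemma has_taylor_powser2:
  assumes N: "powser2_summable r N" and r: "r > 0" and \<zeta>: "norm \<zeta> \<le> r"
  shows "has_taylor n (\<lambda>z. powser2 N z \<zeta>) (\<Sum>k<n. monom (powser2_row N k \<zeta>) k)"
proof (rule has_taylor_cong[OF has_taylor_powser[OF r powser2_rows_summable_on[OF assms]] r])
  show "(\<Sum>\<^sub>\<infinity>k. powser2_row N k \<zeta> * z ^ k) = powser2 N z \<zeta>" if "norm z < r" for z
    using powser2_eq_infsum_rows[OF N _ \<zeta>] that by simp
qed

section \<open>Algebra of 2-jets\<close>

lemma has_taylor3_mult_const:
  assumes "has_taylor 3 f [:a0, a1, a2:]" "has_taylor 3 g [:b0, b1, b2:]"
    and "d > 0" "\<And>z. norm z < d \<Longrightarrow> f z * g z = c"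
  shows "a0 * b1 + a1 * b0 = 0" "a0 * b2 + a1 * b1 + a2 * b0 = 0"
proof -
  have "has_taylor 3 (\<lambda>z. f z * g z) [:c:]"
    using assms(4) by (intro has_taylor_cong[OF has_taylor_const assms(3)]) simp
  note coeffs = has_taylor_unique[OF has_taylor_mult[OF assms(1,2)] this]
  show "a0 * b1 + a1 * b0 = 0" "a0 * b2 + a1 * b1 + a2 * b0 = 0"
    using coeffs[of 1] coeffs[of 2] by (simp_all add: eval_nat_numeral algebra_simps)
qed

lemma hyperbola_curvature:
  fixes \<alpha> \<beta> :: "'a::idom"
  assumes "\<alpha> * \<beta> = \<kappa>" and tangent: "\<alpha> * q1 + \<beta> * p1 = 0" and accel: "\<alpha> * q2 + p1 * q1 + \<beta> * p2 = 0"
  shows "\<kappa> * (p1 * q2 - q1 * p2)\<^sup>2 = - ((p1 * q1) ^ 3)"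
proof -
  have "\<alpha> * (p1 * q2 - q1 * p2) = - (p1\<^sup>2 * q1)" using tangent accel by algebra
  moreover have "\<beta> * (p1 * q2 - q1 * p2) = p1 * q1\<^sup>2" using tangent accel by algebra
  ultimately have "(\<alpha> * (p1 * q2 - q1 * p2)) * (\<beta> * (p1 * q2 - q1 * p2)) = - (p1\<^sup>2 * q1) * (p1 * q1\<^sup>2)"
    by simp
  then show ?thesis
    by (simp add: assms(1)[symmetric] power2_eq_square power3_eq_cube mult_ac)
qed

lemma discriminant_zero_of_square_mod_5:
  fixes q Q :: "'a::field_char_0 poly"
  assumes deg: "degree q \<le> 3" "degree Q \<le> 2"
    and eq: "\<And>i. i < 5 \<Longrightarrow> coeff (smult \<kappa> (q ^ 2)) i = coeff (Q ^ 3) i"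
    and Q0: "coeff Q 0 \<noteq> 0"
  shows "(coeff Q 1)\<^sup>2 = 4 * coeff Q 0 * coeff Q 2"
proof -
  obtain q0 q1 q2 q3 where q: "q = [:q0, q1, q2, q3:]"
    using poly_as_sum_of_monoms'[OF deg(1)]
    by (simp add: eval_nat_numeral monom_Suc monom_0) metis
  obtain Q0 Q1 Q2 where Q: "Q = [:Q0, Q1, Q2:]"
    using poly_as_sum_of_monoms'[OF deg(2)]
    by (simp add: eval_nat_numeral monom_Suc monom_0) metis
  have coeffs: "\<kappa> * q0\<^sup>2 = Q0 ^ 3" "\<kappa> * (2 * q0 * q1) = 3 * Q0\<^sup>2 * Q1"
    "\<kappa> * (2 * q0 * q2 + q1\<^sup>2) = 3 * Q0\<^sup>2 * Q2 + 3 * Q0 * Q1\<^sup>2"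
    "\<kappa> * (2 * q0 * q3 + 2 * q1 * q2) = 6 * Q0 * Q1 * Q2 + Q1 ^ 3"
    "\<kappa> * (2 * q1 * q3 + q2\<^sup>2) = 3 * Q0 * Q2\<^sup>2 + 3 * Q1\<^sup>2 * Q2"
    using eq[of 0] eq[of 1] eq[of 2] eq[of 3] eq[of 4]
    by (simp_all add: q Q eval_nat_numeral algebra_simps)
  have "Q0 \<noteq> 0" "q0 \<noteq> 0" "\<kappa> \<noteq> 0" using coeffs(1) Q0 by (auto simp: Q)
  define t1 t2 t3 s1 s2 where "t1 = q1 / q0" and "t2 = q2 / q0" and "t3 = q3 / q0"
    and "s1 = Q1 / Q0" and "s2 = Q2 / Q0"
  then have scaled: "q1 = q0 * t1" "q2 = q0 * t2" "q3 = q0 * t3" "Q1 = Q0 * s1" "Q2 = Q0 * s2"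
    using \<open>Q0 \<noteq> 0\<close> \<open>q0 \<noteq> 0\<close> by auto
  have cancel: "l = r" if "\<kappa> * (q0\<^sup>2 * l) = Q0 ^ 3 * r" for l r
    using that coeffs(1) \<open>Q0 \<noteq> 0\<close> by (metis mult.assoc mult_left_cancel power_eq_0_iff)
  have "2 * t1 = 3 * s1"
    by (rule cancel) (use coeffs(2) in \<open>simp add: scaled power2_eq_square power3_eq_cube algebra_simps\<close>)
  moreover have "2 * t2 + t1\<^sup>2 = 3 * s2 + 3 * s1\<^sup>2"
    by (rule cancel) (use coeffs(3) in \<open>simp add: scaled power2_eq_square power3_eq_cube algebra_simps\<close>)
  moreover have "2 * t3 + 2 * t1 * t2 = 6 * s1 * s2 + s1 ^ 3"
    by (rule cancel) (use coeffs(4) in \<open>simp add: scaled power2_eq_square power3_eq_cube algebra_simps\<close>)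
  moreover have "2 * t1 * t3 + t2\<^sup>2 = 3 * s2\<^sup>2 + 3 * s1\<^sup>2 * s2"
    by (rule cancel) (use coeffs(5) in \<open>simp add: scaled power2_eq_square power3_eq_cube algebra_simps\<close>)
  ultimately have "(s1\<^sup>2 - 4 * s2)\<^sup>2 = 0" by algebra
  then show ?thesis by (simp add: Q scaled eval_nat_numeral)
qed

text \<open>The first two hypotheses hold on the leaf \<open>z = 0\<close>, the third is a derivative along it and the
  fourth holds on the slice \<open>u = 0\<close>. The conclusion is the fourth plus \<open>j\<close> times the third, minus
  \<open>j\<^sup>2\<close> times the second, plus \<open>m\<close> times the first.\<close>

lemma second_jet_of_segre_variety:
  fixes j m :: "'a::idom"
  assumes "\<alpha>0 * \<beta>1 + \<alpha>1 * \<beta>0 = 0" "\<alpha>0 * \<beta>2 + \<alpha>1 * \<beta>1 + \<alpha>2 * \<beta>0 = 0"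
    and "\<alpha>1 * (q10 + 2 * j * q01) + \<alpha>0 * (q11 + 4 * j * q02) +
      (\<beta>1 * (p10 + 2 * j * p01) + \<beta>0 * (p11 + 4 * j * p02)) = 0"
    and "\<alpha>0 * (q20 + j * q11 + j\<^sup>2 * \<beta>2 + m * (2 * q01 - \<beta>1)) +
      (p10 + j * (2 * p01 - \<alpha>1)) * (q10 + j * (2 * q01 - \<beta>1)) +
      (p20 + j * p11 + j\<^sup>2 * \<alpha>2 + m * (2 * p01 - \<alpha>1)) * \<beta>0 = 0"
  shows "\<alpha>0 * (q20 + 2 * j * q11 + 4 * j\<^sup>2 * q02 + 2 * m * q01) +
    (p10 + 2 * j * p01) * (q10 + 2 * j * q01) +
    \<beta>0 * (p20 + 2 * j * p11 + 4 * j\<^sup>2 * p02 + 2 * m * p01) = 0"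
  using assms by algebra

section \<open>Hypersurfaces in normal form\<close>

definition normal_form :: "(nat \<Rightarrow> nat \<Rightarrow> real \<Rightarrow> complex) \<Rightarrow> (complex \<times> complex) set" where
  "normal_form N = {(z, w). Im w = (norm z)\<^sup>2 + Re (powser2 (\<lambda>k l. N k l (Re w)) z (cnj z))}"

definition leaf_coeff ::
  "(complex \<times> complex \<Rightarrow> complex) \<Rightarrow> (complex \<times> complex \<Rightarrow> complex) \<Rightarrow>
    complex \<Rightarrow> complex \<Rightarrow> nat \<Rightarrow> complex" where
  "leaf_coeff F F' \<zeta> u l = taylor2_coeff F u 0 l + taylor_coeff (\<lambda>w. reflect F' (\<zeta>, w)) u l"

lemma leaf_coeff_0: "leaf_coeff F F' \<zeta> u 0 = F (0, u) + reflect F' (\<zeta>, u)"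
  by (simp add: leaf_coeff_def taylor2_coeff_def)

lemma DERIV_leaf_coeff:
  assumes "F holomorphic2_on bidisc r" "F' holomorphic2_on bidisc r" "(\<zeta>, u) \<in> bidisc r"
  shows "((\<lambda>u. leaf_coeff F F' \<zeta> u l) has_field_derivative
    of_nat (Suc l) * leaf_coeff F F' \<zeta> u (Suc l)) (at u)"
proof -
  have r: "r > 0" using assms(3) le_less_trans[OF norm_ge_zero[of u]] by simp
  have "((\<lambda>u. taylor_coeff (\<lambda>w. reflect F' (\<zeta>, w)) u l) has_field_derivative
      of_nat (Suc l) * taylor_coeff (\<lambda>w. reflect F' (\<zeta>, w)) u (Suc l)) (at u)"
    using assms(3)
    by (intro DERIV_taylor_coeff[of _ "ball 0 r"]
        holomorphic2_on_slice2[OF reflect_holomorphic2_on_bidisc[OF assms(2)]]) auto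
  from DERIV_add[OF DERIV_taylor2_coeff[OF assms(1) r open_ball, of u 0 l] this] show ?thesis
    using assms(3) by (simp add: leaf_coeff_def distrib_left del: of_nat_Suc)
qed

locale normal_form_series =
  fixes r :: real and N :: "nat \<Rightarrow> nat \<Rightarrow> real \<Rightarrow> complex"
  assumes r: "r > 0"
    and N_low: "\<And>k l u. k < 2 \<or> l < 2 \<Longrightarrow> N k l u = 0"
    and N_hermitian: "\<And>k l u. N l k u = cnj (N k l u)"
    and N_summable: "\<And>u. \<bar>u\<bar> < r \<Longrightarrow> powser2_summable r (\<lambda>k l. N k l u)"
begin

definition height :: "real \<Rightarrow> complex \<Rightarrow> complex \<Rightarrow> complex" where
  "height u z \<zeta> = z * \<zeta> + powser2 (\<lambda>k l. N k l u) z \<zeta>"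

definition second_row :: "real \<Rightarrow> complex \<Rightarrow> complex" where
  "second_row u = powser2_row (\<lambda>k l. N k l u) 2"

text \<open>On the hypersurface, where \<open>\<zeta> = cnj z\<close> and \<open>w = u + \<i> height u z (cnj z)\<close>, this is
  \<open>F (z, w) + cnj (F' (z, w))\<close>.\<close>

definition polarized ::
  "(complex \<times> complex \<Rightarrow> complex) \<Rightarrow> (complex \<times> complex \<Rightarrow> complex) \<Rightarrow>
    real \<Rightarrow> complex \<Rightarrow> complex \<Rightarrow> complex" where
  "polarized F F' u z \<zeta> =
    F (z, of_real u + \<i> * height u z \<zeta>) + reflect F' (\<zeta>, of_real u - \<i> * height u z \<zeta>)"

definition transversal_jet1 ::
  "(complex \<times> complex \<Rightarrow> complex) \<Rightarrow> (complex \<times> complex \<Rightarrow> complex) \<Rightarrow> real \<Rightarrow> complex \<Rightarrow> complex" where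
  "transversal_jet1 F F' u \<zeta> = taylor2_coeff F (of_real u) 1 0 +
    \<i> * \<zeta> * (2 * taylor2_coeff F (of_real u) 0 1 - leaf_coeff F F' \<zeta> (of_real u) 1)"

definition transversal_jet2 ::
  "(complex \<times> complex \<Rightarrow> complex) \<Rightarrow> (complex \<times> complex \<Rightarrow> complex) \<Rightarrow> real \<Rightarrow> complex \<Rightarrow> complex" where
  "transversal_jet2 F F' u \<zeta> = taylor2_coeff F (of_real u) 2 0 +
    \<i> * \<zeta> * taylor2_coeff F (of_real u) 1 1 + (\<i> * \<zeta>)\<^sup>2 * leaf_coeff F F' \<zeta> (of_real u) 2 +
    \<i> * second_row u \<zeta> * (2 * taylor2_coeff F (of_real u) 0 1 - leaf_coeff F F' \<zeta> (of_real u) 1)"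

lemma height_0: "height u 0 \<zeta> = 0"
proof -
  have "powser2 (\<lambda>k l. N k l u) 0 \<zeta> = 0"
    unfolding powser2_def by (rule infsum_0) (auto simp: N_low power_0_left)
  then show ?thesis by (simp add: height_def)
qed

lemma cnj_height: "cnj (height u z (cnj z)) = height u z (cnj z)"
  using cnj_powser2[of "\<lambda>k l. N k l u" z "cnj z", OF N_hermitian]
  by (simp add: height_def mult.commute)

lemma holomorphic2_on_height:
  assumes "\<bar>u\<bar> < r" shows "(\<lambda>x. height u (fst x) (snd x)) holomorphic2_on bidisc r"
  unfolding height_def by (intro holomorphic2_intros holomorphic2_on_powser2 N_summable assms)

lemma has_taylor_height:
  assumes "\<bar>u\<bar> < r" "norm \<zeta> < r" shows "has_taylor 3 (\<lambda>z. height u z \<zeta>) [:0, \<zeta>, second_row u \<zeta>:]"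
proof -
  have rows: "powser2_row (\<lambda>k l. N k l u) k \<zeta> = 0" if "k < 2" for k
    using that by (simp add: powser2_row_def N_low)
  have "has_taylor 3 (\<lambda>z. powser2 (\<lambda>k l. N k l u) z \<zeta>) [:0, 0, second_row u \<zeta>:]"
    using has_taylor_powser2[OF N_summable[OF assms(1)] r, of \<zeta> 3] assms(2) rows
    by (simp add: second_row_def eval_nat_numeral monom_Suc monom_0)
  from has_taylor_add[OF has_taylor_mult[OF has_taylor_id has_taylor_const[of _ \<zeta>]] this]
  show ?thesis by (simp add: height_def[abs_def])
qed

lemma has_taylor_second_row:
  assumes "\<bar>u\<bar> < r" "\<And>l. l < k \<Longrightarrow> N 2 l u = 0" shows "has_taylor k (second_row u) 0"
  using has_taylor_powser2_row[OF N_summable[OF assms(1)] r, of k 2] assms(2)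
  by (simp add: second_row_def)

lemma polarized_points_in_bidisc:
  assumes u: "\<bar>u\<bar> < r"
  obtains \<delta> where "\<delta> > 0" "\<And>z \<zeta>. (z, \<zeta>) \<in> bidisc \<delta> \<Longrightarrow>
    (z, of_real u + \<i> * height u z \<zeta>) \<in> bidisc r \<and> (\<zeta>, of_real u - \<i> * height u z \<zeta>) \<in> bidisc r"
proof -
  let ?W = "bidisc r \<inter> (\<lambda>x. height u (fst x) (snd x)) -` ball 0 (r - \<bar>u\<bar>)"
  have "open ?W"
    by (intro continuous_open_preimage holomorphic2_on_imp_continuous_on holomorphic2_on_height u
        open_Times open_ball)
  moreover have "(0, 0) \<in> ?W" using u r by (simp add: height_0)
  ultimately obtain \<delta> where \<delta>: "\<delta> > 0" "cball 0 \<delta> \<times> cball 0 \<delta> \<subseteq> ?W"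
    by (rule open_contains_bidisc)
  have "(z, of_real u + \<i> * height u z \<zeta>) \<in> bidisc r \<and> (\<zeta>, of_real u - \<i> * height u z \<zeta>) \<in> bidisc r"
    if "(z, \<zeta>) \<in> bidisc \<delta>" for z \<zeta>
  proof -
    have "(z, \<zeta>) \<in> ?W" by (rule subsetD[OF \<delta>(2)]) (use that in auto)
    then show ?thesis
      using norm_triangle_ineq[of "of_real u" "\<i> * height u z \<zeta>"]
        norm_triangle_ineq4[of "of_real u" "\<i> * height u z \<zeta>"] by (simp add: norm_mult)
  qed
  with \<delta>(1) show thesis by (rule that)
qed

lemma holomorphic2_on_polarized:
  assumes F: "F holomorphic2_on bidisc r" and F': "F' holomorphic2_on bidisc r" and u: "\<bar>u\<bar> < r"
    and points: "\<And>z \<zeta>. (z, \<zeta>) \<in> bidisc \<delta> \<Longrightarrow>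
      (z, of_real u + \<i> * height u z \<zeta>) \<in> bidisc r \<and> (\<zeta>, of_real u - \<i> * height u z \<zeta>) \<in> bidisc r"
  shows "(\<lambda>x. polarized F F' u (fst x) (snd x)) holomorphic2_on bidisc \<delta>"
proof -
  have in_bidisc: "(fst x, of_real u + \<i> * height u (fst x) (snd x)) \<in> bidisc r"
    "(snd x, of_real u - \<i> * height u (fst x) (snd x)) \<in> bidisc r" if "x \<in> bidisc \<delta>" for x
    using points[of "fst x" "snd x"] that by (simp_all add: mem_Times_iff)
  have "bidisc \<delta> \<subseteq> bidisc r"
    using in_bidisc by (intro subsetI) (simp add: mem_Times_iff)
  then have "(\<lambda>x. height u (fst x) (snd x)) holomorphic2_on bidisc \<delta>"
    by (rule holomorphic2_on_subset[OF holomorphic2_on_height[OF u]])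
  then show ?thesis
    unfolding polarized_def
    by (intro holomorphic2_intros in_bidisc holomorphic2_on_Pair[OF F]
        holomorphic2_on_Pair[OF reflect_holomorphic2_on_bidisc[OF F']])
qed

lemma has_taylor_polarized:
  assumes F: "F holomorphic2_on bidisc r" and F': "F' holomorphic2_on bidisc r"
    and u: "\<bar>u\<bar> < r" and \<zeta>: "norm \<zeta> < r"
  shows "has_taylor 3 (\<lambda>z. polarized F F' u z \<zeta>)
    [:leaf_coeff F F' \<zeta> (of_real u) 0, transversal_jet1 F F' u \<zeta>, transversal_jet2 F F' u \<zeta>:]"
proof -
  have height_jets: "has_taylor 3 (\<lambda>z. \<i> * height u z \<zeta>) [:0, \<i> * \<zeta>, \<i> * second_row u \<zeta>:]"
    "has_taylor 3 (\<lambda>z. - (\<i> * height u z \<zeta>)) [:0, - (\<i> * \<zeta>), - (\<i> * second_row u \<zeta>):]"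
    using has_taylor_cmult[OF has_taylor_height[OF u \<zeta>], of \<i>]
      has_taylor_cmult[OF has_taylor_height[OF u \<zeta>], of "- \<i>"] by simp_all
  have u': "complex_of_real u \<in> ball 0 r" using u by simp
  have hol: "(\<lambda>w. reflect F' (\<zeta>, w)) holomorphic_on ball 0 r"
    using \<zeta> by (intro holomorphic2_on_slice2[OF reflect_holomorphic2_on_bidisc[OF F']]) auto
  have reflect_coeff: "taylor_coeff (\<lambda>w. reflect F' (\<zeta>, w)) u l =
      leaf_coeff F F' \<zeta> u l - taylor2_coeff F u 0 l" for u l
    by (simp add: leaf_coeff_def)
  show ?thesis
    using has_taylor_add[OF has_taylor3_holomorphic2[OF F r open_ball u' height_jets(1)]
        has_taylor3_holomorphic[OF hol open_ball u' height_jets(2)]]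
    by (simp add: polarized_def transversal_jet1_def transversal_jet2_def reflect_coeff
        algebra_simps del: taylor_coeff_0)
qed

end

section \<open>Normal forms contained in a level set of \<open>|P + cnj Q|\<close>\<close>

locale normal_form_in_level_set = normal_form_series +
  fixes R :: real and P Q :: "complex \<times> complex \<Rightarrow> complex"
  assumes R: "R > 0" and hol_P: "P holomorphic2_on bidisc r" and hol_Q: "Q holomorphic2_on bidisc r"
    and level: "\<And>x. x \<in> normal_form N \<inter> bidisc r \<Longrightarrow> norm (P x + cnj (Q x)) = R"
begin

abbreviation "p \<equiv> taylor2_coeff P"
abbreviation "q \<equiv> taylor2_coeff Q"
abbreviation "\<alpha> \<equiv> leaf_coeff P Q"
abbreviation "\<beta> \<equiv> leaf_coeff Q P"

lemma level_on_antidiagonal: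
  assumes "(z, of_real u + \<i> * height u z (cnj z)) \<in> bidisc r"
  shows "polarized P Q u z (cnj z) * polarized Q P u z (cnj z) = of_real (R\<^sup>2)"
proof -
  obtain g where g: "height u z (cnj z) = of_real g"
    using cnj_height by (metis Reals_cnj_iff Reals_cases)
  define w where "w = complex_of_real u + \<i> * of_real g"
  have "g = Re (z * cnj z) + Re (powser2 (\<lambda>k l. N k l u) z (cnj z))"
    using arg_cong[OF g, of Re] by (simp add: height_def)
  then have "Im w = (norm z)\<^sup>2 + Re (powser2 (\<lambda>k l. N k l (Re w)) z (cnj z))"
    by (simp add: w_def cmod_power2) (simp add: power2_eq_square)
  then have "norm (P (z, w) + cnj (Q (z, w))) = R"
    using assms by (intro level) (simp_all add: normal_form_def w_def g)
  moreover have "cnj w = of_real u - \<i> * of_real g" by (simp add: w_def)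
  ultimately show ?thesis
    using complex_norm_square[of "P (z, w) + cnj (Q (z, w))"]
    by (simp add: polarized_def reflect_def g add.commute flip: w_def)
qed

lemma level_polarized:
  assumes u: "\<bar>u\<bar> < r"
  obtains \<delta> where "0 < \<delta>" "\<delta> \<le> r"
    "\<And>z \<zeta>. (z, \<zeta>) \<in> bidisc \<delta> \<Longrightarrow> polarized P Q u z \<zeta> * polarized Q P u z \<zeta> = of_real (R\<^sup>2)"
proof -
  obtain \<delta> where \<delta>: "\<delta> > 0" and points: "\<And>z \<zeta>. (z, \<zeta>) \<in> bidisc \<delta> \<Longrightarrow>
      (z, of_real u + \<i> * height u z \<zeta>) \<in> bidisc r \<and> (\<zeta>, of_real u - \<i> * height u z \<zeta>) \<in> bidisc r"
    by (rule polarized_points_in_bidisc[OF u]) blast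
  define h where
    "h x = polarized P Q u (fst x) (snd x) * polarized Q P u (fst x) (snd x) - of_real (R\<^sup>2)" for x
  have "h (z, \<zeta>) = 0" if "(z, \<zeta>) \<in> bidisc (\<delta> / 2)" for z \<zeta>
  proof (rule holomorphic2_zero_of_zero_on_antidiagonal)
    show "h holomorphic2_on bidisc \<delta>"
      unfolding h_def[abs_def]
      by (intro holomorphic2_intros holomorphic2_on_polarized hol_P hol_Q u points)
    show "h (z, cnj z) = 0" if "norm z < \<delta>" for z
      using level_on_antidiagonal[of z u] points[of z "cnj z"] that by (simp add: h_def)
  qed (use that in auto)
  then show thesis using \<delta> r by (intro that[of "min (\<delta> / 2) r"]) (auto simp: h_def)
qed

lemma leaf_product:
  assumes "(\<zeta>, u) \<in> bidisc r" shows "\<alpha> \<zeta> u 0 * \<beta> \<zeta> u 0 = of_real (R\<^sup>2)"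
proof -
  define h where
    "h x = (P (0, snd x) + reflect Q x) * (Q (0, snd x) + reflect P x) - of_real (R\<^sup>2)" for x
  have "h (\<zeta>, u) = 0"
  proof (rule holomorphic2_zero_of_zero_on_real_slices[OF _ _ assms])
    show "h holomorphic2_on bidisc r"
      unfolding h_def[abs_def] using r
      by (intro holomorphic2_intros holomorphic2_on_Pair[OF hol_P] holomorphic2_on_Pair[OF hol_Q]
          reflect_holomorphic2_on_bidisc hol_P hol_Q) auto
    fix v :: real assume v: "\<bar>v\<bar> < r"
    obtain \<delta> where \<delta>: "0 < \<delta>"
      "\<And>z \<zeta>. (z, \<zeta>) \<in> bidisc \<delta> \<Longrightarrow> polarized P Q v z \<zeta> * polarized Q P v z \<zeta> = of_real (R\<^sup>2)"
      by (rule level_polarized[OF v]) blast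
    show "\<exists>\<delta>>0. \<forall>\<zeta>. norm \<zeta> < \<delta> \<longrightarrow> h (\<zeta>, of_real v) = 0"
      using \<delta>(1) \<delta>(2)[of 0] by (intro exI[of _ \<delta>]) (simp add: h_def polarized_def height_0)
  qed
  then show ?thesis by (simp add: h_def leaf_coeff_0)
qed

lemmas DERIV_alpha = DERIV_leaf_coeff[OF hol_P hol_Q]
lemmas DERIV_beta = DERIV_leaf_coeff[OF hol_Q hol_P]

lemma leaf_product_deriv:
  assumes "(\<zeta>, u) \<in> bidisc r" shows "\<alpha> \<zeta> u 0 * \<beta> \<zeta> u 1 + \<alpha> \<zeta> u 1 * \<beta> \<zeta> u 0 = 0"
proof (rule DERIV_zero_of_constant_on[where S = "ball 0 r"])
  show "((\<lambda>u. \<alpha> \<zeta> u 0 * \<beta> \<zeta> u 0) has_field_derivative \<alpha> \<zeta> u 0 * \<beta> \<zeta> u 1 + \<alpha> \<zeta> u 1 * \<beta> \<zeta> u 0) (at u)"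
    using DERIV_mult[OF DERIV_alpha[OF assms, of 0] DERIV_beta[OF assms, of 0]]
    by (simp add: algebra_simps)
qed (use assms leaf_product in auto)

lemma leaf_product_deriv2:
  assumes "(\<zeta>, u) \<in> bidisc r"
  shows "\<alpha> \<zeta> u 0 * \<beta> \<zeta> u 2 + \<alpha> \<zeta> u 1 * \<beta> \<zeta> u 1 + \<alpha> \<zeta> u 2 * \<beta> \<zeta> u 0 = 0"
proof -
  have "2 * (\<alpha> \<zeta> u 0 * \<beta> \<zeta> u 2 + \<alpha> \<zeta> u 1 * \<beta> \<zeta> u 1 + \<alpha> \<zeta> u 2 * \<beta> \<zeta> u 0) = 0"
  proof (rule DERIV_zero_of_constant_on[where S = "ball 0 r"])
    show "((\<lambda>u. \<alpha> \<zeta> u 0 * \<beta> \<zeta> u 1 + \<alpha> \<zeta> u 1 * \<beta> \<zeta> u 0) has_field_derivative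
        2 * (\<alpha> \<zeta> u 0 * \<beta> \<zeta> u 2 + \<alpha> \<zeta> u 1 * \<beta> \<zeta> u 1 + \<alpha> \<zeta> u 2 * \<beta> \<zeta> u 0)) (at u)"
      using DERIV_add[OF DERIV_mult[OF DERIV_alpha[OF assms, of 0] DERIV_beta[OF assms, of 1]]
          DERIV_mult[OF DERIV_alpha[OF assms, of 1] DERIV_beta[OF assms, of 0]]]
      by (simp add: eval_nat_numeral algebra_simps)
  qed (use assms leaf_product_deriv in auto)
  then show ?thesis by (simp only: mult_eq_0_iff) simp
qed

lemma transversal_product_jets:
  assumes u: "\<bar>u\<bar> < r"
  obtains \<delta> where "0 < \<delta>" "\<delta> \<le> r"
    "\<And>\<zeta>. norm \<zeta> < \<delta> \<Longrightarrow>
      \<alpha> \<zeta> (of_real u) 0 * transversal_jet1 Q P u \<zeta> + transversal_jet1 P Q u \<zeta> * \<beta> \<zeta> (of_real u) 0 = 0"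
    "\<And>\<zeta>. norm \<zeta> < \<delta> \<Longrightarrow>
      \<alpha> \<zeta> (of_real u) 0 * transversal_jet2 Q P u \<zeta> +
      transversal_jet1 P Q u \<zeta> * transversal_jet1 Q P u \<zeta> +
      transversal_jet2 P Q u \<zeta> * \<beta> \<zeta> (of_real u) 0 = 0"
proof -
  obtain \<delta> where \<delta>: "0 < \<delta>" "\<delta> \<le> r"
    and product: "\<And>z \<zeta>. (z, \<zeta>) \<in> bidisc \<delta> \<Longrightarrow> polarized P Q u z \<zeta> * polarized Q P u z \<zeta> = of_real (R\<^sup>2)"
    by (rule level_polarized[OF u]) blast
  have "norm \<zeta> < r" if "norm \<zeta> < \<delta>" for \<zeta> :: complex using that \<delta>(2) by simp
  note jets = has_taylor3_mult_const[OF has_taylor_polarized[OF hol_P hol_Q u this]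
      has_taylor_polarized[OF hol_Q hol_P u this] \<delta>(1) product]
  show thesis by (rule that[OF \<delta>]) (use jets in auto)
qed

text \<open>The first two Taylor coefficients of \<open>F (z, w)\<close> along the Segre variety
  \<open>w = u + 2 \<i> \<zeta> z + 2 \<i> n(\<zeta>) z\<^sup>2 + O(z\<^sup>3)\<close>, the second one at \<open>u = 0\<close> only.\<close>

definition segre_jet1 :: "(complex \<times> complex \<Rightarrow> complex) \<Rightarrow> complex \<Rightarrow> complex \<Rightarrow> complex" where
  "segre_jet1 F u \<zeta> = taylor2_coeff F u 1 0 + 2 * (\<i> * \<zeta>) * taylor2_coeff F u 0 1"

definition segre_jet2 :: "(complex \<times> complex \<Rightarrow> complex) \<Rightarrow> complex \<Rightarrow> complex" where
  "segre_jet2 F \<zeta> = taylor2_coeff F 0 2 0 + 2 * (\<i> * \<zeta>) * taylor2_coeff F 0 1 1 +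
    4 * (\<i> * \<zeta>)\<^sup>2 * taylor2_coeff F 0 0 2 + 2 * (\<i> * second_row 0 \<zeta>) * taylor2_coeff F 0 0 1"

lemma holomorphic2_on_segre_jet1:
  assumes "F holomorphic2_on bidisc r"
  shows "(\<lambda>x. segre_jet1 F (snd x) (fst x)) holomorphic2_on bidisc r"
proof -
  have "(\<lambda>x. taylor2_coeff F (snd x) k l) holomorphic2_on bidisc r" for k l
    by (rule holomorphic2_on_compose[OF holomorphic2_on_snd
          holomorphic_on_taylor2_coeff[OF assms r open_ball]]) auto
  then show ?thesis unfolding segre_jet1_def by (intro holomorphic2_intros)
qed

lemma DERIV_segre_jet1:
  assumes "F holomorphic2_on bidisc r" "u \<in> ball 0 r"
  shows "((\<lambda>u. segre_jet1 F u \<zeta>) has_field_derivative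
    taylor2_coeff F u 1 1 + 4 * (\<i> * \<zeta>) * taylor2_coeff F u 0 2) (at u)"
  using DERIV_add[OF DERIV_taylor2_coeff[OF assms(1) r open_ball assms(2), of 1 0]
      DERIV_cmult[OF DERIV_taylor2_coeff[OF assms(1) r open_ball assms(2), of 0 1], of "2 * (\<i> * \<zeta>)"]]
  by (simp add: segre_jet1_def eval_nat_numeral mult_ac)

lemma segre_tangent:
  assumes "(\<zeta>, u) \<in> bidisc r"
  shows "\<alpha> \<zeta> u 0 * segre_jet1 Q u \<zeta> + \<beta> \<zeta> u 0 * segre_jet1 P u \<zeta> = 0"
proof -
  define h where "h x = (P (0, snd x) + reflect Q x) * segre_jet1 Q (snd x) (fst x) +
    (Q (0, snd x) + reflect P x) * segre_jet1 P (snd x) (fst x)" for x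
  have "h (\<zeta>, u) = 0"
  proof (rule holomorphic2_zero_of_zero_on_real_slices[OF _ _ assms])
    show "h holomorphic2_on bidisc r"
      unfolding h_def[abs_def] using r
      by (intro holomorphic2_intros holomorphic2_on_Pair[OF hol_P] holomorphic2_on_Pair[OF hol_Q]
          reflect_holomorphic2_on_bidisc holomorphic2_on_segre_jet1 hol_P hol_Q) auto
    fix v :: real assume v: "\<bar>v\<bar> < r"
    obtain \<delta> where \<delta>: "0 < \<delta>" "\<delta> \<le> r" and tangent: "\<And>\<zeta>. norm \<zeta> < \<delta> \<Longrightarrow>
        \<alpha> \<zeta> (of_real v) 0 * transversal_jet1 Q P v \<zeta> + transversal_jet1 P Q v \<zeta> * \<beta> \<zeta> (of_real v) 0 = 0"
      by (rule transversal_product_jets[OF v]) blast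
    have "h (\<zeta>, of_real v) = 0" if "norm \<zeta> < \<delta>" for \<zeta>
    proof -
      have "\<alpha> \<zeta> v 0 * \<beta> \<zeta> v 1 + \<alpha> \<zeta> v 1 * \<beta> \<zeta> v 0 = 0"
        using that v \<delta>(2) by (intro leaf_product_deriv) auto
      with tangent[OF that] show ?thesis
        unfolding h_def fst_conv snd_conv leaf_coeff_0[symmetric] transversal_jet1_def segre_jet1_def
        by algebra
    qed
    then show "\<exists>\<delta>>0. \<forall>\<zeta>. norm \<zeta> < \<delta> \<longrightarrow> h (\<zeta>, of_real v) = 0" using \<delta>(1) by blast
  qed
  then show ?thesis by (simp add: h_def leaf_coeff_0)
qed

lemma segre_tangent_deriv:
  assumes "(\<zeta>, u) \<in> bidisc r"
  shows "\<alpha> \<zeta> u 1 * segre_jet1 Q u \<zeta> + \<alpha> \<zeta> u 0 * (q u 1 1 + 4 * (\<i> * \<zeta>) * q u 0 2) +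
    (\<beta> \<zeta> u 1 * segre_jet1 P u \<zeta> + \<beta> \<zeta> u 0 * (p u 1 1 + 4 * (\<i> * \<zeta>) * p u 0 2)) = 0"
proof (rule DERIV_zero_of_constant_on[where S = "ball 0 r"])
  have u: "u \<in> ball 0 r" using assms by simp
  show "((\<lambda>u. \<alpha> \<zeta> u 0 * segre_jet1 Q u \<zeta> + \<beta> \<zeta> u 0 * segre_jet1 P u \<zeta>) has_field_derivative
      \<alpha> \<zeta> u 1 * segre_jet1 Q u \<zeta> + \<alpha> \<zeta> u 0 * (q u 1 1 + 4 * (\<i> * \<zeta>) * q u 0 2) +
      (\<beta> \<zeta> u 1 * segre_jet1 P u \<zeta> + \<beta> \<zeta> u 0 * (p u 1 1 + 4 * (\<i> * \<zeta>) * p u 0 2))) (at u)"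
    using DERIV_add[OF DERIV_mult[OF DERIV_alpha[OF assms, of 0] DERIV_segre_jet1[OF hol_Q u, of \<zeta>]]
        DERIV_mult[OF DERIV_beta[OF assms, of 0] DERIV_segre_jet1[OF hol_P u, of \<zeta>]]]
    by (simp add: algebra_simps)
qed (use assms segre_tangent in auto)

lemma segre_curvature:
  obtains \<delta> where "\<delta> > 0" "\<And>\<zeta>. norm \<zeta> < \<delta> \<Longrightarrow>
    of_real (R\<^sup>2) * (segre_jet1 P 0 \<zeta> * segre_jet2 Q \<zeta> - segre_jet1 Q 0 \<zeta> * segre_jet2 P \<zeta>)\<^sup>2
      = - ((segre_jet1 P 0 \<zeta> * segre_jet1 Q 0 \<zeta>) ^ 3)"
proof -
  have origin: "\<bar>0::real\<bar> < r" using r by simp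
  obtain \<delta> where \<delta>: "0 < \<delta>" "\<delta> \<le> r" and second_order: "\<And>\<zeta>. norm \<zeta> < \<delta> \<Longrightarrow>
      \<alpha> \<zeta> (of_real 0) 0 * transversal_jet2 Q P 0 \<zeta> +
      transversal_jet1 P Q 0 \<zeta> * transversal_jet1 Q P 0 \<zeta> +
      transversal_jet2 P Q 0 \<zeta> * \<beta> \<zeta> (of_real 0) 0 = 0"
    by (rule transversal_product_jets[OF origin]) blast
  have "of_real (R\<^sup>2) * (segre_jet1 P 0 \<zeta> * segre_jet2 Q \<zeta> - segre_jet1 Q 0 \<zeta> * segre_jet2 P \<zeta>)\<^sup>2
      = - ((segre_jet1 P 0 \<zeta> * segre_jet1 Q 0 \<zeta>) ^ 3)" if \<zeta>: "norm \<zeta> < \<delta>" for \<zeta>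
  proof (rule hyperbola_curvature)
    have in_bidisc: "(\<zeta>, 0) \<in> bidisc r" using \<zeta> \<delta> r by simp
    show "\<alpha> \<zeta> 0 0 * \<beta> \<zeta> 0 0 = of_real (R\<^sup>2)" by (rule leaf_product[OF in_bidisc])
    show "\<alpha> \<zeta> 0 0 * segre_jet1 Q 0 \<zeta> + \<beta> \<zeta> 0 0 * segre_jet1 P 0 \<zeta> = 0"
      by (rule segre_tangent[OF in_bidisc])
    show "\<alpha> \<zeta> 0 0 * segre_jet2 Q \<zeta> + segre_jet1 P 0 \<zeta> * segre_jet1 Q 0 \<zeta> + \<beta> \<zeta> 0 0 * segre_jet2 P \<zeta> = 0"
      unfolding segre_jet1_def segre_jet2_def
      by (rule second_jet_of_segre_variety[OF leaf_product_deriv[OF in_bidisc]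
            leaf_product_deriv2[OF in_bidisc] segre_tangent_deriv[OF in_bidisc, unfolded segre_jet1_def]
            second_order[OF \<zeta>, unfolded transversal_jet1_def transversal_jet2_def of_real_0]])
  qed
  with \<delta>(1) show thesis by (rule that)
qed

definition segre_poly1 :: "(complex \<times> complex \<Rightarrow> complex) \<Rightarrow> complex poly" where
  "segre_poly1 F = [:taylor2_coeff F 0 1 0, 2 * \<i> * taylor2_coeff F 0 0 1:]"

definition segre_poly2 :: "(complex \<times> complex \<Rightarrow> complex) \<Rightarrow> complex poly" where
  "segre_poly2 F =
    [:taylor2_coeff F 0 2 0, 2 * \<i> * taylor2_coeff F 0 1 1, - 4 * taylor2_coeff F 0 0 2:]"

lemma has_taylor_segre_jet1: "has_taylor k (segre_jet1 F 0) (segre_poly1 F)"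
  by (simp add: has_taylor_def segre_jet1_def segre_poly1_def algebra_simps)

lemma has_taylor_segre_jet2:
  assumes "\<And>l. l < k \<Longrightarrow> N 2 l 0 = 0"
  shows "has_taylor k (segre_jet2 F) (segre_poly2 F)"
proof -
  have "has_taylor k (second_row 0) 0" using r assms by (intro has_taylor_second_row) auto
  from has_taylor_add[OF has_taylor_poly[of k "segre_poly2 F"]
      has_taylor_cmult[OF this, of "2 * \<i> * taylor2_coeff F 0 0 1"]]
  show ?thesis by (simp add: segre_jet2_def[abs_def] segre_poly2_def algebra_simps power2_eq_square)
qed

lemma segre_curvature_coeff:
  assumes N2: "\<And>l. l < k \<Longrightarrow> N 2 l 0 = 0" and i: "i < k"
  defines "D \<equiv> segre_poly1 P * segre_poly2 Q - segre_poly1 Q * segre_poly2 P"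
  shows "coeff (smult (- of_real (R\<^sup>2)) (D\<^sup>2)) i = coeff ((segre_poly1 P * segre_poly1 Q) ^ 3) i"
proof -
  let ?f = "\<lambda>\<zeta>. - of_real (R\<^sup>2) *
    (segre_jet1 P 0 \<zeta> * segre_jet2 Q \<zeta> - segre_jet1 Q 0 \<zeta> * segre_jet2 P \<zeta>)\<^sup>2"
  let ?g = "\<lambda>\<zeta>. (segre_jet1 P 0 \<zeta> * segre_jet1 Q 0 \<zeta>) ^ 3"
  obtain \<delta> where \<delta>: "\<delta> > 0" "\<And>\<zeta>. norm \<zeta> < \<delta> \<Longrightarrow>
      of_real (R\<^sup>2) * (segre_jet1 P 0 \<zeta> * segre_jet2 Q \<zeta> - segre_jet1 Q 0 \<zeta> * segre_jet2 P \<zeta>)\<^sup>2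
        = - ((segre_jet1 P 0 \<zeta> * segre_jet1 Q 0 \<zeta>) ^ 3)"
    by (rule segre_curvature) blast
  have "has_taylor k ?f (smult (- of_real (R\<^sup>2)) (D\<^sup>2))"
    unfolding D_def
    by (intro has_taylor_cmult has_taylor_power has_taylor_diff has_taylor_mult
        has_taylor_segre_jet1 has_taylor_segre_jet2 N2)
  then have "has_taylor k ?g (smult (- of_real (R\<^sup>2)) (D\<^sup>2))"
    by (rule has_taylor_cong[OF _ \<delta>(1)]) (use \<delta>(2) in simp)
  moreover have "has_taylor k ?g ((segre_poly1 P * segre_poly1 Q) ^ 3)"
    by (intro has_taylor_power has_taylor_mult has_taylor_segre_jet1)
  ultimately show ?thesis using i by (rule has_taylor_unique)
qed

lemma jacobian_zero:
  assumes N2: "N 2 2 0 = 0" "N 2 3 0 = 0" "N 2 4 0 = 0"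
  shows "p 0 1 0 * q 0 0 1 = p 0 0 1 * q 0 1 0"
proof (cases "p 0 1 0 * q 0 1 0 = 0")
  case True
  have origin: "(0, 0) \<in> bidisc r" using r by simp
  have "\<alpha> 0 0 0 * q 0 1 0 + \<beta> 0 0 0 * p 0 1 0 = 0"
    using segre_tangent[OF origin] by (simp add: segre_jet1_def)
  moreover have "\<alpha> 0 0 0 \<noteq> 0" "\<beta> 0 0 0 \<noteq> 0" using leaf_product[OF origin] R by auto
  ultimately have "p 0 1 0 = 0" "q 0 1 0 = 0" using True by auto
  then show ?thesis by simp
next
  case False
  have N2_low: "N 2 l 0 = 0" if "l < 5" for l
  proof -
    from that consider "l < 2" | "l = 2" | "l = 3" | "l = 4" by linarith
    then show ?thesis using N_low N2 by cases auto
  qed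
  let ?S = "segre_poly1 P * segre_poly1 Q"
  have S_coeffs: "coeff ?S 0 = p 0 1 0 * q 0 1 0"
    "coeff ?S 1 = 2 * \<i> * (p 0 1 0 * q 0 0 1 + p 0 0 1 * q 0 1 0)"
    "coeff ?S 2 = - 4 * (p 0 0 1 * q 0 0 1)"
    by (simp_all add: segre_poly1_def eval_nat_numeral algebra_simps)
  have "(coeff ?S 1)\<^sup>2 = 4 * coeff ?S 0 * coeff ?S 2"
  proof (rule discriminant_zero_of_square_mod_5[OF _ _ segre_curvature_coeff[OF N2_low]])
    show "degree (segre_poly1 P * segre_poly2 Q - segre_poly1 Q * segre_poly2 P) \<le> 3" "degree ?S \<le> 2"
      by (simp_all add: segre_poly1_def segre_poly2_def)
    show "coeff ?S 0 \<noteq> 0" unfolding S_coeffs by (rule False)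
  qed
  then have "- 4 * (p 0 1 0 * q 0 0 1 + p 0 0 1 * q 0 1 0)\<^sup>2 =
      - 16 * (p 0 1 0 * q 0 1 0) * (p 0 0 1 * q 0 0 1)"
    unfolding S_coeffs by (simp add: power_mult_distrib)
  then have "(p 0 1 0 * q 0 0 1 - p 0 0 1 * q 0 1 0)\<^sup>2 = 0" by algebra
  then show ?thesis by simp
qed

end

lemma (in normal_form_series) jacobian_zero_of_circular_tube:
  assumes R: "R > 0" and hol: "X holomorphic2_on bidisc r" "Y holomorphic2_on bidisc r"
    and tube: "\<And>x. x \<in> normal_form N \<inter> bidisc r \<Longrightarrow> (Re (X x))\<^sup>2 + (Re (Y x))\<^sup>2 = R\<^sup>2"
    and N2: "N 2 2 0 = 0" "N 2 3 0 = 0" "N 2 4 0 = 0"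
  shows "deriv (\<lambda>z. X (z, 0)) 0 * deriv (\<lambda>w. Y (0, w)) 0 =
    deriv (\<lambda>w. X (0, w)) 0 * deriv (\<lambda>z. Y (z, 0)) 0"
proof -
  define P Q where "P x = X x + \<i> * Y x" and "Q x = X x - \<i> * Y x" for x
  interpret normal_form_in_level_set r N "2 * R" P Q
  proof
    show "2 * R > 0" using R by simp
    show "P holomorphic2_on bidisc r" "Q holomorphic2_on bidisc r"
      unfolding P_def[abs_def] Q_def[abs_def] by (intro holomorphic2_intros hol)+
    show "norm (P x + cnj (Q x)) = 2 * R" if "x \<in> normal_form N \<inter> bidisc r" for x
    proof -
      have "P x + cnj (Q x) = Complex (2 * Re (X x)) (2 * Re (Y x))"
        by (simp add: P_def Q_def complex_eq_iff)
      then have "(norm (P x + cnj (Q x)))\<^sup>2 = 4 * ((Re (X x))\<^sup>2 + (Re (Y x))\<^sup>2)"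
        by (simp add: cmod_power2 power_mult_distrib)
      also have "\<dots> = (2 * R)\<^sup>2" unfolding tube[OF that] by (simp add: power_mult_distrib)
      finally show ?thesis by (rule power2_eq_imp_eq) (use R in auto)
    qed
  qed
  have slices: "(\<lambda>z. F (z, 0)) field_differentiable at 0" "(\<lambda>w. F (0, w)) field_differentiable at 0"
    if "F holomorphic2_on bidisc r" for F
    using holomorphic2_on_slice1[OF that open_ball] holomorphic2_on_slice2[OF that open_ball] r
      holomorphic_on_imp_differentiable_at[of _ "ball 0 r"] by auto
  have "deriv (\<lambda>z. P (z, 0)) 0 = deriv (\<lambda>z. X (z, 0)) 0 + \<i> * deriv (\<lambda>z. Y (z, 0)) 0"
    "deriv (\<lambda>z. Q (z, 0)) 0 = deriv (\<lambda>z. X (z, 0)) 0 - \<i> * deriv (\<lambda>z. Y (z, 0)) 0"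
    "deriv (\<lambda>w. P (0, w)) 0 = deriv (\<lambda>w. X (0, w)) 0 + \<i> * deriv (\<lambda>w. Y (0, w)) 0"
    "deriv (\<lambda>w. Q (0, w)) 0 = deriv (\<lambda>w. X (0, w)) 0 - \<i> * deriv (\<lambda>w. Y (0, w)) 0"
    unfolding P_def Q_def by (simp_all add: slices hol deriv_cmult field_differentiable_mult)
  with jacobian_zero[OF N2, unfolded taylor2_coeff_partials]
  have "2 * \<i> * (deriv (\<lambda>z. X (z, 0)) 0 * deriv (\<lambda>w. Y (0, w)) 0)
      = 2 * \<i> * (deriv (\<lambda>w. X (0, w)) 0 * deriv (\<lambda>z. Y (z, 0)) 0)"
    by (simp add: algebra_simps)
  then show ?thesis by simp
qed

section \<open>The domain and its boundary\<close>

definition log_sq :: "complex \<times> complex \<Rightarrow> real" where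
  "log_sq x = (ln (cmod (fst x)))\<^sup>2 + (ln (cmod (snd x)))\<^sup>2"

definition off_axes :: "(complex \<times> complex) set" where
  "off_axes = {x. fst x \<noteq> 0 \<and> snd x \<noteq> 0}"

lemma open_off_axes: "open off_axes"
  unfolding off_axes_def by (intro open_Collect_conj open_Collect_neq continuous_intros)

lemma Deps_eq: "Deps \<epsilon> = {x \<in> off_axes. log_sq x < \<epsilon>\<^sup>2}"
  by (auto simp: Deps_def off_axes_def log_sq_def)

lemma continuous_on_log_sq: "continuous_on off_axes log_sq"
  unfolding log_sq_def off_axes_def by (intro continuous_intros) auto

lemma log_sq_exp: "log_sq (exp x, exp y) = (Re x)\<^sup>2 + (Re y)\<^sup>2"
  by (simp add: log_sq_def)

lemma off_axes_imp_exp: "x \<in> off_axes \<Longrightarrow> \<exists>u v. x = (exp u, exp v)"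
  by (intro exI[of _ "Ln (fst x)"] exI[of _ "Ln (snd x)"]) (simp add: off_axes_def)

lemma open_Deps: "open (Deps \<epsilon>)"
proof -
  have "open (off_axes \<inter> log_sq -` {..<\<epsilon>\<^sup>2})"
    using continuous_on_log_sq open_off_axes by (intro continuous_open_preimage) auto
  then show ?thesis by (simp add: Deps_eq Int_def vimage_def)
qed

lemma cmod_bounds_of_log_sq_le:
  assumes "x \<in> off_axes" "log_sq x \<le> \<epsilon>\<^sup>2" "\<epsilon> \<ge> 0"
  shows "cmod (fst x) \<in> {exp (- \<epsilon>)..exp \<epsilon>}" "cmod (snd x) \<in> {exp (- \<epsilon>)..exp \<epsilon>}"
proof -
  have bounds: "t \<in> {exp (- \<epsilon>)..exp \<epsilon>}" if "(ln t)\<^sup>2 \<le> \<epsilon>\<^sup>2" "t > 0" for t :: real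
  proof -
    have "\<bar>ln t\<bar> \<le> \<epsilon>" using that(1) assms(3) by (simp flip: abs_le_square_iff)
    then have "exp (- \<epsilon>) \<le> exp (ln t)" "exp (ln t) \<le> exp \<epsilon>" by (auto simp only: exp_le_cancel_iff)
    then show ?thesis using that(2) by simp
  qed
  show "cmod (fst x) \<in> {exp (- \<epsilon>)..exp \<epsilon>}" "cmod (snd x) \<in> {exp (- \<epsilon>)..exp \<epsilon>}"
    using assms(1,2) by (auto intro!: bounds simp del: atLeastAtMost_iff
        simp: off_axes_def log_sq_def intro: order_trans[rotated])
qed

lemma closed_log_sq_le:
  assumes "\<epsilon> \<ge> 0" shows "closed {x \<in> off_axes. log_sq x \<le> \<epsilon>\<^sup>2}"
proof -
  let ?K = "{x :: complex \<times> complex. exp (- \<epsilon>) \<le> cmod (fst x) \<and> exp (- \<epsilon>) \<le> cmod (snd x)}"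
  have K: "closed ?K" by (intro closed_Collect_conj closed_Collect_le continuous_intros)
  have sub: "?K \<subseteq> off_axes"
    by (auto simp: off_axes_def)
  have "closed (?K \<inter> log_sq -` {..\<epsilon>\<^sup>2})"
    by (intro continuous_closed_preimage continuous_on_subset[OF continuous_on_log_sq sub] K
        closed_atMost)
  moreover have "?K \<inter> log_sq -` {..\<epsilon>\<^sup>2} = {x \<in> off_axes. log_sq x \<le> \<epsilon>\<^sup>2}"
    using sub cmod_bounds_of_log_sq_le[OF _ _ assms] by auto
  ultimately show ?thesis by simp
qed

lemma closure_Deps:
  assumes "\<epsilon> > 0" shows "closure (Deps \<epsilon>) = {x \<in> off_axes. log_sq x \<le> \<epsilon>\<^sup>2}"
proof
  show "closure (Deps \<epsilon>) \<subseteq> {x \<in> off_axes. log_sq x \<le> \<epsilon>\<^sup>2}"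
    using assms by (intro closure_minimal closed_log_sq_le) (auto simp: Deps_eq)
  show "{x \<in> off_axes. log_sq x \<le> \<epsilon>\<^sup>2} \<subseteq> closure (Deps \<epsilon>)"
  proof
    fix x assume x: "x \<in> {x \<in> off_axes. log_sq x \<le> \<epsilon>\<^sup>2}"
    then obtain u v where uv: "x = (exp u, exp v)" using off_axes_imp_exp by blast
    define \<gamma> where "\<gamma> t = (exp (of_real t * u), exp (of_real t * v))" for t :: real
    have "\<gamma> ` closure {0..<1} \<subseteq> closure (Deps \<epsilon>)"
    proof (rule image_closure_subset)
      show "continuous_on (closure {0..<1}) \<gamma>" unfolding \<gamma>_def[abs_def] by (intro continuous_intros)
      show "\<gamma> ` {0..<1} \<subseteq> closure (Deps \<epsilon>)"
      proof (rule image_subsetI)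
        fix t :: real assume t: "t \<in> {0..<1}"
        have "log_sq (\<gamma> t) = t\<^sup>2 * log_sq x"
          by (simp add: \<gamma>_def uv log_sq_exp power_mult_distrib distrib_left)
        also have "\<dots> \<le> t\<^sup>2 * \<epsilon>\<^sup>2" using x by (intro mult_left_mono) auto
        also have "\<dots> < 1 * \<epsilon>\<^sup>2"
          using t assms by (intro mult_strict_right_mono) (auto simp: abs_square_less_1)
        finally have "\<gamma> t \<in> Deps \<epsilon>" by (simp add: Deps_eq off_axes_def \<gamma>_def)
        then show "\<gamma> t \<in> closure (Deps \<epsilon>)" using closure_subset by blast
      qed
    qed auto
    moreover have "x = \<gamma> 1" "1 \<in> closure {0..<1::real}" by (auto simp: \<gamma>_def uv)
    ultimately show "x \<in> closure (Deps \<epsilon>)" by blast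
  qed
qed

lemma frontier_Deps:
  assumes "\<epsilon> > 0" shows "frontier (Deps \<epsilon>) = {x \<in> off_axes. log_sq x = \<epsilon>\<^sup>2}"
  unfolding frontier_def closure_Deps[OF assms] interior_open[OF open_Deps] by (auto simp: Deps_eq)

lemma bounded_Deps:
  assumes "\<epsilon> \<ge> 0" shows "bounded (Deps \<epsilon>)"
proof (rule bounded_subset)
  show "bounded (cball (0::complex) (exp \<epsilon>) \<times> cball (0::complex) (exp \<epsilon>))"
    by (intro bounded_Times bounded_cball)
  show "Deps \<epsilon> \<subseteq> cball 0 (exp \<epsilon>) \<times> cball 0 (exp \<epsilon>)"
    using cmod_bounds_of_log_sq_le[OF _ _ assms] by (auto simp: Deps_eq mem_Times_iff)
qed

lemma connected_Deps:
  assumes "\<epsilon> \<ge> 0" shows "connected (Deps \<epsilon>)"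
proof -
  define Re2 :: "complex \<times> complex \<Rightarrow> real \<times> real" where "Re2 x = (Re (fst x), Re (snd x))" for x
  define exp2 :: "complex \<times> complex \<Rightarrow> complex \<times> complex"
    where "exp2 x = (exp (fst x), exp (snd x))" for x
  have "linear Re2" unfolding Re2_def by (auto intro!: linearI)
  then have "convex (Re2 -` ball 0 \<epsilon>)" by (intro convex_linear_vimage convex_ball)
  then have "connected (exp2 ` (Re2 -` ball 0 \<epsilon>))"
    unfolding exp2_def by (intro connected_continuous_image convex_connected continuous_intros)
  moreover have in_tube: "x \<in> Re2 -` ball 0 \<epsilon> \<longleftrightarrow> exp2 x \<in> Deps \<epsilon>" for x
  proof -
    have "x \<in> Re2 -` ball 0 \<epsilon> \<longleftrightarrow> sqrt ((Re (fst x))\<^sup>2 + (Re (snd x))\<^sup>2) < sqrt (\<epsilon>\<^sup>2)"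
      using assms by (simp add: Re2_def norm_Pair)
    then show ?thesis
      by (simp only: real_sqrt_less_iff) (simp add: Deps_eq off_axes_def exp2_def log_sq_exp)
  qed
  have "exp2 ` (Re2 -` ball 0 \<epsilon>) = Deps \<epsilon>"
  proof
    show "exp2 ` (Re2 -` ball 0 \<epsilon>) \<subseteq> Deps \<epsilon>" using in_tube by blast
    show "Deps \<epsilon> \<subseteq> exp2 ` (Re2 -` ball 0 \<epsilon>)"
    proof
      fix x assume x: "x \<in> Deps \<epsilon>"
      then obtain u v where "x = exp2 (u, v)"
        using off_axes_imp_exp[of x] by (auto simp: Deps_eq exp2_def)
      then show "x \<in> exp2 ` (Re2 -` ball 0 \<epsilon>)" using x in_tube by blast
    qed
  qed
  ultimately show ?thesis by simp
qed

definition ln_cmod_sq_grad :: "complex \<Rightarrow> complex" where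
  "ln_cmod_sq_grad z = (2 * ln (cmod z)) *\<^sub>R cnj (inverse z)"

definition ln_cmod_sq_hess :: "complex \<Rightarrow> complex \<Rightarrow> complex" where
  "ln_cmod_sq_hess z s = (2 * Re (s / z)) *\<^sub>R cnj (inverse z) - (2 * ln (cmod z)) *\<^sub>R cnj (s / z\<^sup>2)"

lemma inner_cnj_left: "inner (cnj a) b = Re (a * b)"
  by (simp add: inner_complex_def)

lemma has_derivative_ln_cmod:
  assumes "z \<noteq> 0" shows "((\<lambda>z. ln (cmod z)) has_derivative (\<lambda>s. Re (s / z))) (at z)"
proof -
  have "((\<lambda>z. ln (cmod z)) has_derivative (\<lambda>s. inner (sgn z) s * inverse (cmod z))) (at z)"
    using assms by (auto intro!: derivative_eq_intros has_derivative_norm[OF assms] simp: inner_commute)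
  moreover have "inner (sgn z) s * inverse (cmod z) = Re (s / z)" for s
    using assms cmod_power2[of z]
    by (simp add: inner_complex_def sgn_div_norm Re_divide power2_eq_square field_simps)
  ultimately show ?thesis by simp
qed

lemma has_derivative_ln_cmod_sq:
  assumes "z \<noteq> 0"
  shows "((\<lambda>z. (ln (cmod z))\<^sup>2) has_derivative (\<lambda>s. inner (ln_cmod_sq_grad z) s)) (at z)"
  using has_derivative_mult[OF has_derivative_ln_cmod[OF assms] has_derivative_ln_cmod[OF assms]]
  unfolding power2_eq_square
  by (rule has_derivative_eq_rhs)
    (auto simp: ln_cmod_sq_grad_def inner_cnj_left divide_inverse mult_ac simp del: complex_cnj_inverse)

lemma has_derivative_ln_cmod_sq_grad:
  assumes "z \<noteq> 0" shows "(ln_cmod_sq_grad has_derivative ln_cmod_sq_hess z) (at z)"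
proof -
  have "(inverse has_derivative (\<lambda>s. - (s / z\<^sup>2))) (at z)"
    using assms by (auto intro!: derivative_eq_intros simp: divide_simps power2_eq_square)
  from has_derivative_scaleR[OF has_derivative_mult_right[OF has_derivative_ln_cmod[OF assms], of 2]
      has_derivative_cnj[OF this]]
  show ?thesis unfolding ln_cmod_sq_grad_def[abs_def] ln_cmod_sq_hess_def
    by (rule has_derivative_eq_rhs) (auto simp: scaleR_conv_of_real algebra_simps)
qed

lemma bounded_linear_ln_cmod_sq_hess: "bounded_linear (ln_cmod_sq_hess z)"
  unfolding ln_cmod_sq_hess_def divide_inverse
  by (intro bounded_linear_sub bounded_linear_scaleR_const bounded_linear_const_scaleR
      bounded_linear_const_mult bounded_linear_mult_const bounded_linear_compose[OF bounded_linear_Re]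
      bounded_linear_compose[OF bounded_linear_cnj] bounded_linear_ident)

lemma ln_cmod_sq_hess_levi:
  "inner (ln_cmod_sq_hess z s) s + inner (ln_cmod_sq_hess z (\<i> * s)) (\<i> * s) = 2 * (cmod (s / z))\<^sup>2"
proof -
  have hess: "inner (ln_cmod_sq_hess z s) s =
      2 * (Re (s / z))\<^sup>2 - 2 * ln (cmod z) * Re ((s / z)\<^sup>2)" for s
    unfolding ln_cmod_sq_hess_def inner_diff_left inner_scaleR_left inner_cnj_left
    by (simp add: divide_inverse power2_eq_square mult_ac)
  define v where "v = s / z"
  have "\<i> * s / z = \<i> * v" by (simp add: v_def)
  then show ?thesis by (simp add: hess cmod_power2 power_mult_distrib flip: v_def)
qed

definition log_sq_deriv :: "complex \<times> complex \<Rightarrow> (complex \<times> complex) \<Rightarrow>\<^sub>L real" where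
  "log_sq_deriv x = blinfun_inner_right (ln_cmod_sq_grad (fst x), ln_cmod_sq_grad (snd x))"

definition log_sq_deriv2 ::
  "complex \<times> complex \<Rightarrow> (complex \<times> complex) \<Rightarrow>\<^sub>L ((complex \<times> complex) \<Rightarrow>\<^sub>L real)" where
  "log_sq_deriv2 x = Blinfun (\<lambda>s.
    blinfun_inner_right (ln_cmod_sq_hess (fst x) (fst s), ln_cmod_sq_hess (snd x) (snd s)))"

lemma log_sq_deriv2_apply:
  "blinfun_apply (log_sq_deriv2 x) s =
    blinfun_inner_right (ln_cmod_sq_hess (fst x) (fst s), ln_cmod_sq_hess (snd x) (snd s))"
  unfolding log_sq_deriv2_def
  by (subst bounded_linear_Blinfun_apply)
    (auto intro!: bounded_linear_compose[OF bounded_linear_blinfun_inner_right] bounded_linear_Pair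
      bounded_linear_compose[OF bounded_linear_ln_cmod_sq_hess] bounded_linear_fst bounded_linear_snd)

lemma C2_fun_log_sq: "C2_fun off_axes (\<lambda>x. log_sq x - c) log_sq_deriv log_sq_deriv2"
  unfolding C2_fun_def
proof (intro conjI ballI open_off_axes)
  fix x assume "x \<in> off_axes"
  then have x: "fst x \<noteq> 0" "snd x \<noteq> 0" by (auto simp: off_axes_def)
  have proj: "(fst has_derivative fst) (at x)" "(snd has_derivative snd) (at x)"
    by (auto intro!: derivative_eq_intros)
  have "(log_sq has_derivative
      (\<lambda>s. inner (ln_cmod_sq_grad (fst x)) (fst s) + inner (ln_cmod_sq_grad (snd x)) (snd s))) (at x)"
    unfolding log_sq_def[abs_def]
    by (intro has_derivative_add has_derivative_compose[OF proj(1) has_derivative_ln_cmod_sq[OF x(1)]]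
        has_derivative_compose[OF proj(2) has_derivative_ln_cmod_sq[OF x(2)]])
  from has_derivative_diff[OF this has_derivative_const[of c]]
  show "((\<lambda>x. log_sq x - c) has_derivative blinfun_apply (log_sq_deriv x)) (at x)"
    by (rule has_derivative_eq_rhs) (auto simp: log_sq_deriv_def inner_prod_def)
  have "((\<lambda>x. (ln_cmod_sq_grad (fst x), ln_cmod_sq_grad (snd x))) has_derivative
      (\<lambda>s. (ln_cmod_sq_hess (fst x) (fst s), ln_cmod_sq_hess (snd x) (snd s)))) (at x)"
    by (intro has_derivative_Pair
        has_derivative_compose[OF proj(1) has_derivative_ln_cmod_sq_grad[OF x(1)]]
        has_derivative_compose[OF proj(2) has_derivative_ln_cmod_sq_grad[OF x(2)]])
  from bounded_linear.has_derivative[OF bounded_linear_blinfun_inner_right this]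
  show "(log_sq_deriv has_derivative blinfun_apply (log_sq_deriv2 x)) (at x)"
    unfolding log_sq_deriv_def[abs_def] by (rule has_derivative_eq_rhs) (auto simp: log_sq_deriv2_apply)
next
  show "continuous_on off_axes log_sq_deriv2"
  proof (rule continuous_on_blinfun_componentwise)
    show "continuous_on off_axes (\<lambda>x. blinfun_apply (log_sq_deriv2 x) s)" for s
      unfolding log_sq_deriv2_apply ln_cmod_sq_hess_def off_axes_def
      by (intro bounded_linear.continuous_on[OF bounded_linear_blinfun_inner_right]
          continuous_intros) auto
  qed
qed

lemma log_sq_deriv_radial:
  assumes "x \<in> off_axes"
  shows "blinfun_apply (log_sq_deriv x)
    (ln (cmod (fst x)) *\<^sub>R fst x, ln (cmod (snd x)) *\<^sub>R snd x) = 2 * log_sq x"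
proof -
  have "inner (ln_cmod_sq_grad z) (ln (cmod z) *\<^sub>R z) = 2 * (ln (cmod z))\<^sup>2" if "z \<noteq> 0" for z
    using that unfolding ln_cmod_sq_grad_def inner_scaleR_left inner_scaleR_right inner_cnj_left
    by (simp add: power2_eq_square)
  then show ?thesis using assms by (simp add: log_sq_deriv_def log_sq_def off_axes_def)
qed

lemma levi_form_log_sq:
  "levi_form log_sq_deriv2 x t = ((cmod (fst t / fst x))\<^sup>2 + (cmod (snd t / snd x))\<^sup>2) / 2"
proof -
  have "levi_form log_sq_deriv2 x t =
      ((inner (ln_cmod_sq_hess (fst x) (fst t)) (fst t) +
        inner (ln_cmod_sq_hess (fst x) (\<i> * fst t)) (\<i> * fst t)) +
       (inner (ln_cmod_sq_hess (snd x) (snd t)) (snd t) +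
        inner (ln_cmod_sq_hess (snd x) (\<i> * snd t)) (\<i> * snd t))) / 4"
    by (simp add: levi_form_def log_sq_deriv2_apply cmul_def inner_prod_def)
  then show ?thesis unfolding ln_cmod_sq_hess_levi by simp
qed

lemma levi_pos_at_log_sq:
  assumes "x \<in> off_axes" "log_sq x \<noteq> 0"
  shows "levi_pos_at log_sq_deriv log_sq_deriv2 x"
proof -
  have "log_sq_deriv x \<noteq> 0"
    using log_sq_deriv_radial[OF assms(1)] assms(2) by auto
  moreover have "levi_form log_sq_deriv2 x t > 0" if "t \<noteq> 0" for t
  proof -
    have "fst t / fst x \<noteq> 0 \<or> snd t / snd x \<noteq> 0"
      using that assms(1) by (auto simp: prod_eq_iff off_axes_def)
    then show ?thesis unfolding levi_form_log_sq by (auto simp: add_pos_nonneg add_nonneg_pos)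
  qed
  ultimately show ?thesis by (simp add: levi_pos_at_def)
qed

lemma spsc_domain_Deps:
  assumes "\<epsilon> > 0" shows "spsc_domain (Deps \<epsilon>)"
  unfolding spsc_domain_def
proof (intro conjI exI)
  show "Deps \<epsilon> \<noteq> {}" using assms by (auto simp: Deps_def intro!: exI[of _ 1])
  show "C2_fun off_axes (\<lambda>x. log_sq x - \<epsilon>\<^sup>2) log_sq_deriv log_sq_deriv2" by (rule C2_fun_log_sq)
  show "\<forall>x\<in>frontier (Deps \<epsilon>). levi_pos_at log_sq_deriv log_sq_deriv2 x"
    using assms by (auto simp: frontier_Deps intro!: levi_pos_at_log_sq)
  show "frontier (Deps \<epsilon>) \<subseteq> off_axes" using assms by (auto simp: frontier_Deps)
  show "Deps \<epsilon> \<inter> off_axes = {x \<in> off_axes. log_sq x - \<epsilon>\<^sup>2 < 0}" by (auto simp: Deps_eq)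
qed (use assms in \<open>auto intro: open_Deps connected_Deps\<close>)

lemma spsc_hypersurface_Deps:
  assumes "\<epsilon> > 0" shows "spsc_hypersurface (frontier (Deps \<epsilon>))"
  unfolding spsc_hypersurface_def
proof (intro ballI exI conjI)
  show "C2_fun off_axes (\<lambda>x. log_sq x - \<epsilon>\<^sup>2) log_sq_deriv log_sq_deriv2" by (rule C2_fun_log_sq)
qed (use assms in \<open>auto simp: frontier_Deps intro!: levi_pos_at_log_sq\<close>)

section \<open>Absence of umbilical points\<close>

lemma holo2_on_has_field_derivative_curve:
  assumes L: "(\<Psi> has_derivative L) (at (p t, q t))" "\<forall>c v. L (cmul c v) = cmul c (L v)"
    and p: "(p has_field_derivative a) (at t)" and q: "(q has_field_derivative b) (at t)"
  shows "((\<lambda>t. fst (\<Psi> (p t, q t))) has_field_derivative fst (L (a, b))) (at t)"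
    and "((\<lambda>t. snd (\<Psi> (p t, q t))) has_field_derivative snd (L (a, b))) (at t)"
proof -
  have "((\<lambda>t. \<Psi> (p t, q t)) has_derivative (\<lambda>h. L (a * h, b * h))) (at t)"
    using has_derivative_compose[OF has_derivative_Pair, of p _ t UNIV q _ \<Psi> L] p q L(1)
    by (simp add: has_field_derivative_def)
  moreover have "L (a * h, b * h) = cmul h (L (a, b))" for h
    using L(2)[rule_format, of h "(a, b)"] by (simp add: cmul_def mult.commute)
  ultimately have "((\<lambda>t. \<Psi> (p t, q t)) has_derivative (\<lambda>h. cmul h (L (a, b)))) (at t)" by simp
  from has_derivative_fst[OF this] has_derivative_snd[OF this]
  show "((\<lambda>t. fst (\<Psi> (p t, q t))) has_field_derivative fst (L (a, b))) (at t)"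
    and "((\<lambda>t. snd (\<Psi> (p t, q t))) has_field_derivative snd (L (a, b))) (at t)"
    by (auto simp: has_field_derivative_def cmul_def mult.commute elim!: has_derivative_eq_rhs)
qed

lemma holo2_on_imp_holomorphic2_on:
  assumes "holo2_on V \<Psi>"
  shows "(\<lambda>x. fst (\<Psi> x)) holomorphic2_on V" "(\<lambda>x. snd (\<Psi> x)) holomorphic2_on V"
proof -
  have cont: "continuous_on V \<Psi>"
    using assms unfolding holo2_on_def
    by (intro continuous_at_imp_continuous_on ballI) (meson has_derivative_continuous)
  have "(\<lambda>t. fst (\<Psi> (p t, q t))) holomorphic_on S \<and> (\<lambda>t. snd (\<Psi> (p t, q t))) holomorphic_on S"
    if S: "open S" and pq: "p holomorphic_on S" "q holomorphic_on S"
      and V: "\<And>t. t \<in> S \<Longrightarrow> (p t, q t) \<in> V" for S p q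
    unfolding holomorphic_on_open[OF S]
  proof (intro conjI ballI)
    fix t assume t: "t \<in> S"
    obtain L where "(\<Psi> has_derivative L) (at (p t, q t))" "\<forall>c v. L (cmul c v) = cmul c (L v)"
      using assms V[OF t] unfolding holo2_on_def by blast
    from holo2_on_has_field_derivative_curve[OF this
        holomorphic_derivI[OF pq(1) S t] holomorphic_derivI[OF pq(2) S t]]
    show "\<exists>f'. ((\<lambda>t. fst (\<Psi> (p t, q t))) has_field_derivative f') (at t)"
      "\<exists>f'. ((\<lambda>t. snd (\<Psi> (p t, q t))) has_field_derivative f') (at t)" by blast+
  qed
  then show "(\<lambda>x. fst (\<Psi> x)) holomorphic2_on V" "(\<lambda>x. snd (\<Psi> x)) holomorphic2_on V"
    by (auto intro!: holomorphic2_onI continuous_on_fst continuous_on_snd cont)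
qed

lemma biholo_inverse_derivative:
  assumes \<Phi>: "biholo U \<Phi>" and x: "x \<in> U"
  obtains L where "(the_inv_into U \<Phi> has_derivative L) (at (\<Phi> x))"
    "\<forall>c v. L (cmul c v) = cmul c (L v)" "surj L"
proof -
  have U: "open U" "inj_on \<Phi> U" using \<Phi> by (auto simp: biholo_def)
  obtain L' where L': "(\<Phi> has_derivative L') (at x)"
    using \<Phi> x unfolding biholo_def holo2_on_def by blast
  obtain L where L: "(the_inv_into U \<Phi> has_derivative L) (at (\<Phi> x))" "\<forall>c v. L (cmul c v) = cmul c (L v)"
    using \<Phi> x unfolding biholo_def holo2_on_def by blast
  have "((\<lambda>y. the_inv_into U \<Phi> (\<Phi> y)) has_derivative (\<lambda>v. L (L' v))) (at x)"
    by (rule has_derivative_compose[OF L' L(1)])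
  then have "((\<lambda>y. y) has_derivative (\<lambda>v. L (L' v))) (at x)"
    by (rule has_derivative_transform_within_open[OF _ U(1) x]) (rule the_inv_into_f_f[OF U(2)])
  then have "(\<lambda>v. L (L' v)) = (\<lambda>v. v)"
    by (rule has_derivative_unique) (rule has_derivative_ident)
  then have "surj L" by (metis surjI)
  with L show thesis by (rule that)
qed

lemma det_nonzero_of_surj:
  assumes L: "linear L" "\<forall>c v. L (cmul c v) = cmul c (L v)" and surj: "surj L"
  shows "fst (L (1, 0)) * snd (L (0, 1)) \<noteq> fst (L (0, 1)) * snd (L (1, 0))"
proof
  assume det: "fst (L (1, 0)) * snd (L (0, 1)) = fst (L (0, 1)) * snd (L (1, 0))"
  have columns: "L v = (fst v * fst (L (1, 0)) + snd v * fst (L (0, 1)),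
      fst v * snd (L (1, 0)) + snd v * snd (L (0, 1)))" for v
  proof -
    have "v = cmul (fst v) (1, 0) + cmul (snd v) (0, 1)" by (simp add: cmul_def)
    then have "L v = cmul (fst v) (L (1, 0)) + cmul (snd v) (L (0, 1))"
      using linear_add[OF L(1)] L(2) by metis
    then show ?thesis by (simp add: cmul_def)
  qed
  obtain v w where "L v = (1, 0)" "L w = (0, 1)" using surj by (metis surjD)
  with columns[of v] columns[of w]
  have "fst v * fst (L (1, 0)) + snd v * fst (L (0, 1)) = 1"
    "fst v * snd (L (1, 0)) + snd v * snd (L (0, 1)) = 0"
    "fst w * fst (L (1, 0)) + snd w * fst (L (0, 1)) = 0"
    "fst w * snd (L (1, 0)) + snd w * snd (L (0, 1)) = 1"
    by simp_all
  with det have "(1::complex) = 0" by algebra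
  then show False by simp
qed

lemma holomorphic_log_on_ball:
  assumes "z0 \<noteq> 0"
  obtains g where "g holomorphic_on ball z0 (cmod z0)" "deriv g z0 \<noteq> 0"
    "\<forall>z \<in> ball z0 (cmod z0). Re (g z) = ln (cmod z)"
proof -
  have "contractible (ball z0 (cmod z0))" by (intro convex_imp_contractible convex_ball)
  then obtain g where g: "g holomorphic_on ball z0 (cmod z0)"
    "\<And>z. z \<in> ball z0 (cmod z0) \<Longrightarrow> z = exp (g z)"
    by (rule contractible_imp_holomorphic_log[OF holomorphic_on_ident]) (auto simp: dist_norm)
  show thesis
  proof (rule that[OF g(1)])
    show "\<forall>z \<in> ball z0 (cmod z0). Re (g z) = ln (cmod z)"
    proof
      fix z assume "z \<in> ball z0 (cmod z0)"
      from arg_cong[OF g(2)[OF this], of cmod] show "Re (g z) = ln (cmod z)" by simp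
    qed
    have z0: "z0 \<in> ball z0 (cmod z0)" using assms by simp
    have "((\<lambda>z. exp (g z)) has_field_derivative exp (g z0) * deriv g z0) (at z0)"
      using holomorphic_derivI[OF g(1) open_ball z0] by (rule DERIV_fun_exp)
    then have "((\<lambda>z. z) has_field_derivative exp (g z0) * deriv g z0) (at z0)"
      by (rule has_field_derivative_transform_within_open[OF _ open_ball z0]) (use g(2) in auto)
    from DERIV_unique[OF this DERIV_ident] show "deriv g z0 \<noteq> 0" by auto
  qed
qed

lemma umbilicalE:
  assumes "umbilical M x"
  obtains V \<Psi> L N where "open V" "(0, 0) \<in> V" "holo2_on V \<Psi>" "\<Psi> (0, 0) = x"
    "(\<Psi> has_derivative L) (at (0, 0))" "\<forall>c v. L (cmul c v) = cmul c (L v)" "surj L"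
    "\<Psi> ` (V \<inter> normal_form N) \<subseteq> M"
    "\<forall>k l u. k < 2 \<or> l < 2 \<longrightarrow> N k l u = 0" "\<forall>k l u. N l k u = cnj (N k l u)"
    "\<forall>z w. (z, w) \<in> V \<longrightarrow> (\<lambda>(k, l). norm (N k l (Re w) * z ^ k * cnj z ^ l)) summable_on UNIV"
    "N 2 2 0 = 0" "N 2 3 0 = 0" "N 2 4 0 = 0"
proof -
  from assms obtain U \<Phi> N where x: "x \<in> U" and \<Phi>: "biholo U \<Phi>" "\<Phi> x = (0, 0)"
    and N: "\<forall>k l u. (k < 2 \<or> l < 2) \<longrightarrow> N k l u = 0" "\<forall>k l u. N l k u = cnj (N k l u)"
      "\<forall>u. N 2 2 u = 0 \<and> N 2 3 u = 0 \<and> N 3 3 u = 0"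
      "\<forall>z w. (z, w) \<in> \<Phi> ` U \<longrightarrow> (\<lambda>(k, l). norm (N k l (Re w) * z ^ k * cnj z ^ l)) summable_on UNIV"
    and image: "\<Phi> ` (M \<inter> U) = {(z, w). (z, w) \<in> \<Phi> ` U \<and>
          Im w = (cmod z)\<^sup>2 + Re (infsum (\<lambda>(k, l). N k l (Re w) * z ^ k * cnj z ^ l) UNIV)}"
    and "N 2 4 0 = 0"
    unfolding umbilical_def by (elim exE conjE) (rule that; assumption)
  have inv: "the_inv_into U \<Phi> (\<Phi> y) = y" if "y \<in> U" for y
    using \<Phi>(1) that by (auto simp: biholo_def intro: the_inv_into_f_f)
  obtain L where L: "(the_inv_into U \<Phi> has_derivative L) (at (\<Phi> x))"
    "\<forall>c v. L (cmul c v) = cmul c (L v)" "surj L"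
    by (rule biholo_inverse_derivative[OF \<Phi>(1) x])
  have "\<Phi> ` U \<inter> normal_form N = \<Phi> ` (M \<inter> U)"
    unfolding image normal_form_def powser2_def by auto
  then have image': "the_inv_into U \<Phi> ` (\<Phi> ` U \<inter> normal_form N) \<subseteq> M" using inv by auto
  show thesis
  proof (rule that[of "\<Phi> ` U" "the_inv_into U \<Phi>" L N])
    show "open (\<Phi> ` U)" "holo2_on (\<Phi> ` U) (the_inv_into U \<Phi>)" using \<Phi>(1) by (simp_all add: biholo_def)
    show "(0, 0) \<in> \<Phi> ` U" using imageI[OF x, of \<Phi>] by (simp only: \<Phi>(2))
    show "the_inv_into U \<Phi> (0, 0) = x" using inv[OF x] by (simp only: \<Phi>(2))
    show "(the_inv_into U \<Phi> has_derivative L) (at (0, 0))" using L(1) by (simp only: \<Phi>(2))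
    show "N 2 2 0 = 0" "N 2 3 0 = 0" using N(3) by auto
  qed fact+
qed

lemma jacobian_nonzero_of_componentwise_compose:
  assumes L: "(\<Psi> has_derivative L) (at (0, 0))" "\<forall>c v. L (cmul c v) = cmul c (L v)" "surj L"
    and g: "(g has_field_derivative g') (at (fst (\<Psi> (0, 0))))" "g' \<noteq> 0"
    and h: "(h has_field_derivative h') (at (snd (\<Psi> (0, 0))))" "h' \<noteq> 0"
  shows "deriv (\<lambda>z. g (fst (\<Psi> (z, 0)))) 0 * deriv (\<lambda>w. h (snd (\<Psi> (0, w)))) 0 \<noteq>
    deriv (\<lambda>w. g (fst (\<Psi> (0, w)))) 0 * deriv (\<lambda>z. h (snd (\<Psi> (z, 0)))) 0"
proof -
  have chain: "deriv (\<lambda>t. f (k t)) 0 = D * E"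
    if "(k has_field_derivative E) (at 0)" "(f has_field_derivative D) (at (k 0))"
    for f k :: "complex \<Rightarrow> complex" and D E
    by (rule DERIV_imp_deriv, rule DERIV_chain2[OF _ that(1)], rule that(2))
  note slice1 = holo2_on_has_field_derivative_curve[where p = "\<lambda>z. z" and q = "\<lambda>_. 0" and t = 0,
      OF L(1,2) DERIV_ident DERIV_const]
  note slice2 = holo2_on_has_field_derivative_curve[where p = "\<lambda>_. 0" and q = "\<lambda>w. w" and t = 0,
      OF L(1,2) DERIV_const DERIV_ident]
  have "deriv (\<lambda>z. g (fst (\<Psi> (z, 0)))) 0 = g' * fst (L (1, 0))"
    "deriv (\<lambda>w. g (fst (\<Psi> (0, w)))) 0 = g' * fst (L (0, 1))"
    "deriv (\<lambda>z. h (snd (\<Psi> (z, 0)))) 0 = h' * snd (L (1, 0))"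
    "deriv (\<lambda>w. h (snd (\<Psi> (0, w)))) 0 = h' * snd (L (0, 1))"
    using g(1) h(1) by (intro chain slice1 slice2; simp)+
  moreover have "fst (L (1, 0)) * snd (L (0, 1)) \<noteq> fst (L (0, 1)) * snd (L (1, 0))"
    using L has_derivative_linear by (intro det_nonzero_of_surj)
  ultimately show ?thesis using g(2) h(2) by simp
qed

lemma local_log_coordinates:
  assumes V: "open V" "(0, 0) \<in> V" and \<Psi>: "holo2_on V \<Psi>" "\<Psi> (0, 0) \<in> off_axes"
    and L: "(\<Psi> has_derivative L) (at (0, 0))" "\<forall>c v. L (cmul c v) = cmul c (L v)" "surj L"
  obtains r X Y where "r > 0" "cball 0 r \<times> cball 0 r \<subseteq> V"
    "X holomorphic2_on bidisc r" "Y holomorphic2_on bidisc r"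
    "\<forall>x \<in> bidisc r. log_sq (\<Psi> x) = (Re (X x))\<^sup>2 + (Re (Y x))\<^sup>2"
    "deriv (\<lambda>z. X (z, 0)) 0 * deriv (\<lambda>w. Y (0, w)) 0 \<noteq> deriv (\<lambda>w. X (0, w)) 0 * deriv (\<lambda>z. Y (z, 0)) 0"
proof -
  define z0 w0 where "z0 = fst (\<Psi> (0, 0))" and "w0 = snd (\<Psi> (0, 0))"
  let ?B = "ball z0 (cmod z0)" and ?C = "ball w0 (cmod w0)"
  have nz: "z0 \<noteq> 0" "w0 \<noteq> 0" using \<Psi>(2) by (auto simp: z0_def w0_def off_axes_def)
  note hol_\<Psi> = holo2_on_imp_holomorphic2_on[OF \<Psi>(1)]
  have "open ((V \<inter> (\<lambda>x. fst (\<Psi> x)) -` ?B) \<inter> (V \<inter> (\<lambda>x. snd (\<Psi> x)) -` ?C))" (is "open ?W")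
    by (intro open_Int continuous_open_preimage holomorphic2_on_imp_continuous_on hol_\<Psi> V open_ball)
  moreover have "(0, 0) \<in> ?W" using V nz by (simp add: z0_def w0_def)
  ultimately obtain r where r: "r > 0" "cball 0 r \<times> cball 0 r \<subseteq> ?W" by (rule open_contains_bidisc)
  have W: "x \<in> ?W" if "x \<in> bidisc r" for x
    by (rule subsetD[OF r(2)]) (use that in \<open>auto simp: mem_Times_iff\<close>)
  obtain g where g: "g holomorphic_on ?B" "deriv g z0 \<noteq> 0" "\<forall>z \<in> ?B. Re (g z) = ln (cmod z)"
    by (rule holomorphic_log_on_ball[OF nz(1)])
  obtain h where h: "h holomorphic_on ?C" "deriv h w0 \<noteq> 0" "\<forall>w \<in> ?C. Re (h w) = ln (cmod w)"
    by (rule holomorphic_log_on_ball[OF nz(2)])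
  show thesis
  proof (rule that[of r "\<lambda>x. g (fst (\<Psi> x))" "\<lambda>x. h (snd (\<Psi> x))"])
    show "r > 0" "cball 0 r \<times> cball 0 r \<subseteq> V" using r by auto
    have V: "bidisc r \<subseteq> V" and B: "\<And>x. x \<in> bidisc r \<Longrightarrow> fst (\<Psi> x) \<in> ?B"
      and C: "\<And>x. x \<in> bidisc r \<Longrightarrow> snd (\<Psi> x) \<in> ?C"
      using W by blast+
    show "(\<lambda>x. g (fst (\<Psi> x))) holomorphic2_on bidisc r" "(\<lambda>x. h (snd (\<Psi> x))) holomorphic2_on bidisc r"
      by (rule holomorphic2_on_compose[OF holomorphic2_on_subset[OF hol_\<Psi>(1) V] g(1) B]
          holomorphic2_on_compose[OF holomorphic2_on_subset[OF hol_\<Psi>(2) V] h(1) C]; assumption)+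
    show "\<forall>x \<in> bidisc r. log_sq (\<Psi> x) = (Re (g (fst (\<Psi> x))))\<^sup>2 + (Re (h (snd (\<Psi> x))))\<^sup>2"
      using B C g(3) h(3) by (simp add: log_sq_def)
    show "deriv (\<lambda>z. g (fst (\<Psi> (z, 0)))) 0 * deriv (\<lambda>w. h (snd (\<Psi> (0, w)))) 0 \<noteq>
        deriv (\<lambda>w. g (fst (\<Psi> (0, w)))) 0 * deriv (\<lambda>z. h (snd (\<Psi> (z, 0)))) 0"
    proof (rule jacobian_nonzero_of_componentwise_compose[OF L _ g(2) _ h(2)])
      show "(g has_field_derivative deriv g z0) (at (fst (\<Psi> (0, 0))))"
        "(h has_field_derivative deriv h w0) (at (snd (\<Psi> (0, 0))))"
        using nz by (auto simp: z0_def w0_def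
            intro!: holomorphic_derivI[OF g(1)] holomorphic_derivI[OF h(1)])
    qed
  qed
qed

lemma frontier_Deps_not_umbilical:
  assumes \<epsilon>: "\<epsilon> > 0" and x: "x \<in> frontier (Deps \<epsilon>)"
  shows "\<not> umbilical (frontier (Deps \<epsilon>)) x"
proof
  assume "umbilical (frontier (Deps \<epsilon>)) x"
  then obtain V \<Psi> L N where V: "open V" "(0, 0) \<in> V" and \<Psi>: "holo2_on V \<Psi>" "\<Psi> (0, 0) = x"
    and L: "(\<Psi> has_derivative L) (at (0, 0))" "\<forall>c v. L (cmul c v) = cmul c (L v)" "surj L"
    and image: "\<Psi> ` (V \<inter> normal_form N) \<subseteq> frontier (Deps \<epsilon>)"
    and N: "\<forall>k l u. k < 2 \<or> l < 2 \<longrightarrow> N k l u = 0" "\<forall>k l u. N l k u = cnj (N k l u)"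
      "\<forall>z w. (z, w) \<in> V \<longrightarrow> (\<lambda>(k, l). norm (N k l (Re w) * z ^ k * cnj z ^ l)) summable_on UNIV"
    and N2: "N 2 2 0 = 0" "N 2 3 0 = 0" "N 2 4 0 = 0"
    by (rule umbilicalE)
  have "\<Psi> (0, 0) \<in> off_axes" using x \<epsilon> \<Psi>(2) by (simp add: frontier_Deps)
  then obtain r X Y where r_pos: "r > 0" and bidisc: "cball 0 r \<times> cball 0 r \<subseteq> V"
    and hol: "X holomorphic2_on bidisc r" "Y holomorphic2_on bidisc r"
    and log_sq: "\<forall>x \<in> bidisc r. log_sq (\<Psi> x) = (Re (X x))\<^sup>2 + (Re (Y x))\<^sup>2"
    and jacobian: "deriv (\<lambda>z. X (z, 0)) 0 * deriv (\<lambda>w. Y (0, w)) 0 \<noteq>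
      deriv (\<lambda>w. X (0, w)) 0 * deriv (\<lambda>z. Y (z, 0)) 0"
    by (rule local_log_coordinates[OF V \<Psi>(1) _ L])
  interpret normal_form_series r N
  proof
    show "powser2_summable r (\<lambda>k l. N k l u)" if "\<bar>u\<bar> < r" for u
    proof -
      have "(complex_of_real r, complex_of_real u) \<in> V"
        by (rule subsetD[OF bidisc]) (use r_pos that in auto)
      from N(3)[rule_format, OF this] show ?thesis
        using r_pos by (simp add: powser2_summable_def norm_mult norm_power)
    qed
    show "N l k u = cnj (N k l u)" for k l u using N(2) by blast
  qed (use r_pos N(1) in auto)
  have "(Re (X y))\<^sup>2 + (Re (Y y))\<^sup>2 = \<epsilon>\<^sup>2" if y: "y \<in> normal_form N \<inter> bidisc r" for y
  proof -
    have "y \<in> V" by (rule subsetD[OF bidisc]) (use y in \<open>auto simp: mem_Times_iff\<close>)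
    then have "\<Psi> y \<in> frontier (Deps \<epsilon>)" using image y by blast
    then show ?thesis using bspec[OF log_sq, of y] y \<epsilon> by (simp add: frontier_Deps)
  qed
  from jacobian_zero_of_circular_tube[OF \<epsilon> hol this N2] jacobian show False by blast
qed

theorem theorem1p1:
  fixes \<epsilon> :: real
  assumes "\<epsilon> > 0"
  shows "bounded (Deps \<epsilon>) \<and> spsc_domain (Deps \<epsilon>) \<and>
         compact (frontier (Deps \<epsilon>)) \<and> spsc_hypersurface (frontier (Deps \<epsilon>)) \<and>
         (\<forall>p \<in> frontier (Deps \<epsilon>). \<not> umbilical (frontier (Deps \<epsilon>)) p)"
proof (intro conjI ballI)
  show "bounded (Deps \<epsilon>)" using assms by (intro bounded_Deps) simp
  then show "compact (frontier (Deps \<epsilon>))" by (rule compact_frontier_bounded)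
qed (use assms in \<open>auto intro: spsc_domain_Deps spsc_hypersurface_Deps
      frontier_Deps_not_umbilical[THEN notE]\<close>)

end
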